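(* Let $2\le s\le r\le n-2$ and let $P=P(m_1,\dots,m_{n-1})$ be a natural unit interval order with $m_1=r$, $m_2=\cdots=m_s=n-1$ and $m_{s+1}=\cdots=m_{n-1}=n$; let $G=\mathrm{inc}(P)$. Then $$X_G(\mathbf{x},t)=[n-4]_t!\left\{\overline{C}_n(t)\,e_n+\overline{C}_{(n-1,1)}(t)\,e_{(n-1,1)}+\overline{C}_{(n-2,2)}(t)\,e_{(n-2,2)}\right\},$$ where $\overline{C}_n(t)=[n]_t[n-3]_t[r-1]_t[n-s-1]_t$, $\overline{C}_{(n-2,2)}(t)=t^{n+r-s-3}[2]_t[n-r-1]_t[s-1]_t$, and $\overline{C}_{(n-1,1)}(t)=\tfrac12[n-2]_t\left\{t^{r-1}(1+t^{n-r-s})[n-3]_t+t^{n-s-1}[2]_t[r-2]_t[s-1]_t+t^{r-1}[2]_t[n-r-1]_t[n-s-2]_t\right\}$. Moreover $X_G(\mathbf{x},t)$ is $e$-positive and $e$-unimodal with center of symmetry $\frac{\binom{n}{2}-(n-r+s-1)}{2}$.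
   Context: A natural unit interval order $P(m_1,\dots,m_{n-1})$ is defined for integers $m_1\le\cdots\le m_{n-1}\le n$ with $m_i\ge i$: it is the poset on $[n]$ with $i<_P j$ iff $i<n$ and $j\in\{m_i+1,\dots,n\}$. Its incomparability graph has vertex set $[n]$ and an edge $\{i,j\}$ ($i<j$) iff $j\le m_i$. The chromatic quasisymmetric function of a graph $G$ on $V\subset\mathbb{P}$ is $X_G(\mathbf{x},t)=\sum_\kappa t^{\mathrm{asc}(\kappa)}\prod_v x_{\kappa(v)}$ over proper colorings $\kappa:V\to\mathbb{P}$, with $\mathrm{asc}(\kappa)$ the number of edges $\{i,j\}$, $i<j$, with $\kappa(i)<\kappa(j)$. $[m]_t=1+t+\cdots+t^{m-1}$, $[m]_t!=[1]_t\cdots[m]_t$, $[0]_t!=1$; $e_\lambda$ denotes elementary symmetric functions. Writing $X_G(\mathbf{x},t)=\sum_{i=0}^m a_i(\mathbf{x})t^i$ with symmetric functions $a_i$, $X_G$ is $e$-positive if each $a_i$ is a nonnegative combination of the $e_\lambda$, and $e$-unimodal with center of symmetry $c$ if it is palindromic about $c$ ($a_i=a_{2c-i}$) and $a_{i+1}-a_i$ is $e$-positive for $0\le i<c$ (equivalently here, every coefficient of $e_\lambda$ is a unimodal polynomial with nonnegative coefficients, palindromic with center $c$). *)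

theory Defs
  imports "HOL-Library.FuncSet" "HOL-Computational_Algebra.Polynomial"
begin

(* Formal power series in the variables x_0, x_1, x_2, ... (x_k plays the role of the
   paper's x_{k+1}); a series is given by its coefficient function on monomials,
   a monomial being an exponent vector nat => nat (finitely supported ones matter). *)
type_synonym 'a series = "(nat \<Rightarrow> nat) \<Rightarrow> 'a"

definition ser_one :: "'a::comm_semiring_1 series" where
  "ser_one \<alpha> = (if \<alpha> = (\<lambda>_. 0) then 1 else 0)"

definition ser_mult :: "'a::comm_semiring_1 series \<Rightarrow> 'a series \<Rightarrow> 'a series" where
  "ser_mult f g \<alpha> = (\<Sum>\<beta> \<in> {\<beta>. \<forall>i. \<beta> i \<le> \<alpha> i}. f \<beta> * g (\<lambda>i. \<alpha> i - \<beta> i))"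

definition elem :: "nat \<Rightarrow> 'a::comm_semiring_1 series" where
  "elem k \<alpha> = (if (\<forall>i. \<alpha> i \<le> 1) \<and> finite {i. \<alpha> i \<noteq> 0} \<and> card {i. \<alpha> i = 1} = k
                then 1 else 0)"

definition elem_part :: "nat list \<Rightarrow> 'a::comm_semiring_1 series" where
  "elem_part lam = foldr ser_mult (map elem lam) ser_one"

definition is_partition :: "nat list \<Rightarrow> bool" where
  "is_partition lam \<longleftrightarrow> sorted (rev lam) \<and> (\<forall>k \<in> set lam. 0 < k)"

definition e_pos :: "rat series \<Rightarrow> bool" where
  "e_pos f \<longleftrightarrow> (\<exists>L c. finite L \<and> (\<forall>lam \<in> L. is_partition lam \<and> c lam \<ge> 0) \<and>
       f = (\<lambda>\<alpha>. \<Sum>lam \<in> L. c lam * elem_part lam \<alpha>))"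

definition tcoeff :: "rat poly series \<Rightarrow> nat \<Rightarrow> rat series" where
  "tcoeff X i = (\<lambda>\<alpha>. coeff (X \<alpha>) i)"

definition e_positive :: "rat poly series \<Rightarrow> bool" where
  "e_positive X \<longleftrightarrow> (\<forall>i. e_pos (tcoeff X i))"

(* palindromic with center c (a_i = a_{2c-i}, with a_j = 0 for j < 0) and
   a_{i+1} - a_i e-positive for 0 <= i < c *)
definition e_unimodal :: "rat poly series \<Rightarrow> rat \<Rightarrow> bool" where
  "e_unimodal X c \<longleftrightarrow> (\<exists>d::nat. of_nat d = 2 * c \<and>
      (\<forall>i. tcoeff X i = (if i \<le> d then tcoeff X (d - i) else (\<lambda>_. 0))) \<and>
      (\<forall>i. of_nat i < c \<longrightarrow> e_pos (\<lambda>\<alpha>. tcoeff X (Suc i) \<alpha> - tcoeff X i \<alpha>)))"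

(* chromatic quasisymmetric function of a graph on a finite vertex set V of naturals
   with edge relation E; colours are natural numbers (colour k <-> variable x_k) *)
definition asc :: "nat set \<Rightarrow> (nat \<Rightarrow> nat \<Rightarrow> bool) \<Rightarrow> (nat \<Rightarrow> nat) \<Rightarrow> nat" where
  "asc V E \<kappa> = card {(i, j). i \<in> V \<and> j \<in> V \<and> i < j \<and> E i j \<and> \<kappa> i < \<kappa> j}"

definition proper_col :: "nat set \<Rightarrow> (nat \<Rightarrow> nat \<Rightarrow> bool) \<Rightarrow> (nat \<Rightarrow> nat) \<Rightarrow> bool" where
  "proper_col V E \<kappa> \<longleftrightarrow> (\<forall>i \<in> V. \<forall>j \<in> V. E i j \<longrightarrow> \<kappa> i \<noteq> \<kappa> j)"

definition chrom_qsf :: "nat set \<Rightarrow> (nat \<Rightarrow> nat \<Rightarrow> bool) \<Rightarrow> rat poly series" where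
  "chrom_qsf V E \<alpha> =
     (\<Sum>\<kappa> \<in> {\<kappa>. \<kappa> \<in> V \<rightarrow>\<^sub>E UNIV \<and> proper_col V E \<kappa> \<and>
                  (\<forall>c. card {v \<in> V. \<kappa> v = c} = \<alpha> c)}.
        [:0, 1:] ^ asc V E \<kappa>)"

definition nuio_less :: "nat \<Rightarrow> (nat \<Rightarrow> nat) \<Rightarrow> nat \<Rightarrow> nat \<Rightarrow> bool" where
  "nuio_less n m i j \<longleftrightarrow> i \<in> {1..n} \<and> j \<in> {1..n} \<and> i < n \<and> m i < j"

definition inc_edge :: "nat \<Rightarrow> (nat \<Rightarrow> nat) \<Rightarrow> nat \<Rightarrow> nat \<Rightarrow> bool" where
  "inc_edge n m i j \<longleftrightarrow> i \<noteq> j \<and> \<not> nuio_less n m i j \<and> \<not> nuio_less n m j i"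

definition qint :: "nat \<Rightarrow> rat poly" where
  "qint k = (\<Sum>i<k. [:0, 1:] ^ i)"

definition qfact :: "nat \<Rightarrow> rat poly" where
  "qfact k = (\<Prod>i = 1..k. qint i)"

end

theory Submission
  imports Defs
begin

text \<open>
  In \<open>G\<close> the vertices \<open>2, \<dots>, n - 1\<close> form a clique, and the only non-edges join \<open>1\<close> to the vertices
  above \<open>r\<close> and \<open>n\<close> to the vertices up to \<open>s\<close>; as \<open>s \<le> r\<close>, a colour is used at most twice, and at most
  two colours are used twice. Removing the class of the largest colour leaves a graph of the same kind,
  determined up to isomorphism by the sizes \<open>a, b, k\<close> of the three blocks \<open>{2..s}\<close>, \<open>{s+1..r}\<close>,
  \<open>{r+1..n-1}\<close> and by which of the vertices \<open>1\<close>, \<open>n\<close> survive. This gives recursions for the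
  coefficients of \<open>X\<^sub>G\<close> at monomials, whose solutions depend only on the number of colours used
  twice, not on their position; hence \<open>X\<^sub>G\<close> is symmetric and the expansion in \<open>e\<^sub>n\<close>, \<open>e\<^sub>(\<^sub>n\<^sub>-\<^sub>1\<^sub>,\<^sub>1\<^sub>)\<close>,
  \<open>e\<^sub>(\<^sub>n\<^sub>-\<^sub>2\<^sub>,\<^sub>2\<^sub>)\<close> is read off by a triangular change of basis. Unimodality follows
  because multiplication by \<open>[k]\<^sub>t\<close> preserves nonnegative palindromic unimodal polynomials.
\<close>

subsection \<open>The coefficient polynomials and their recursions\<close>

text \<open>Write [k] for \<open>qint k\<close> and [k]! for \<open>qfact k\<close>. The closed
  forms are built backwards from the expansion to be proved. At a monomial of degree N with d
  squared variables, e_N, e_(N-1,1), e_(N-2,2) have coefficients 1, N, C(N,2) if d = 0, then 0, 1,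
  N-2 if d = 1, and 0, 0, 1 if d = 2. With one end vertex, M = a + b > 0 and N = M + 1, the
  e-coefficients are [M-1]! [b] [N] and t^b [a] [M-1]! = [M]! - [b] [M-1]!; inserting the latter
  form for d = 0 gives \<open>one_end_poly\<close>. Two obstacles shape the proof. The largest
  colour may be used once or twice, and the same closed form must satisfy the recursion of either
  case. Moreover the induction passes through all smaller block sizes, empty blocks included, where
  subtraction on naturals truncates. Polynomials for a block of size a - 1 therefore occur only
  multiplied by [a], which vanishes for a = 0, and the few clique sizes at which the factorial
  relations fail are treated separately.\<close>

lemma poly_qint: "t \<noteq> 1 \<Longrightarrow> poly (qint k) t = (t ^ k - 1) / (t - 1)"
  by (simp add: qint_def poly_sum sum_gp_strict poly_power field_simps)

text \<open>The excluded points are those where the rational expressions below divide by t or t - 1;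
  a nonzero difference would have only finitely many roots.\<close>

lemma rat_poly_eqI:
  fixes p q :: "rat poly"
  assumes "\<And>t. t \<noteq> 0 \<Longrightarrow> t \<noteq> 1 \<Longrightarrow> poly p t = poly q t"
  shows "p = q"
proof (rule ccontr)
  assume "p \<noteq> q"
  then have "finite {t. poly (p - q) t = 0}"
    by (intro poly_roots_finite) simp
  moreover have "- {0, 1} \<subseteq> {t. poly (p - q) t = 0}"
    using assms by auto
  ultimately have "finite (- {0, 1 :: rat})"
    using finite_subset by blast
  then show False
    by (simp add: infinite_UNIV_char_0)
qed

lemma qfact_Suc: "qfact (Suc k) = qint (Suc k) * qfact k"
  by (simp add: qfact_def mult.commute)

text \<open>
  Coefficient polynomials at a monomial with \<open>d\<close> squared variables, when exactly one end vertex
  (\<open>one_end_poly\<close>) or both end vertices (\<open>two_ends_poly\<close>) are present. They are written so that they remain correct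
  for small cliques, where \<open>a + b - 1\<close> or \<open>a + b + k - 2\<close> is truncated: the factor in front then vanishes.
\<close>

definition one_end_poly :: "nat \<Rightarrow> nat \<Rightarrow> nat \<Rightarrow> rat poly" where
  "one_end_poly d a b =
     (if d = 0 then qfact (a + b - 1) * qint b * (qint (a + b + 1) - of_nat (a + b + 1))
        + of_nat (a + b + 1) * qfact (a + b)
      else if d = 1 then [:0, 1:] ^ b * qint a * qfact (a + b - 1) else 0)"

text \<open>The two pairs are {1, v} and {u, n}, with u in the first and v in the last block; the
  factor [2] records which of them has the larger colour.\<close>

definition two_ends_poly2 :: "nat \<Rightarrow> nat \<Rightarrow> nat \<Rightarrow> rat poly" where
  "two_ends_poly2 a b k = [:0, 1:] ^ (a + 2 * b + k - 1) * qint 2 * qint a * qint k * qfact (a + b + k - 2)"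

text \<open>Obtained by letting the squared colour be the largest: its class is {1, v}, {u, n} or
  {1, n}, and \<open>one_end_poly 0\<close> is inserted for what remains in the first two
  cases.\<close>

definition two_ends_poly1 :: "nat \<Rightarrow> nat \<Rightarrow> nat \<Rightarrow> rat poly" where
  "two_ends_poly1 a b k =
     ([:0, 1:] ^ (a + b) * (qint k * qint (b + k - 1)) + [:0, 1:] ^ (b + k + 1) * (qint a * qint (a + b - 1)))
       * (qint (a + b + k) - of_nat (a + b + k)) * qfact (a + b + k - 2)
     + of_nat (a + b + k) * qfact (a + b + k - 1) * ([:0, 1:] ^ (a + b) * qint k + [:0, 1:] ^ (b + k + 1) * qint a)
     + [:0, 1:] ^ (b + k) * qfact (a + b + k)"

text \<open>With N = M + 2 vertices and e-coefficients c0, c1, c2, the values at d = 2, 1, 0 are c2,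
  c1 + M c2 and c0 + N c1 + C(N,2) c2. Eliminating c1 from the last one produces the factor N M -
  C(N,2); the first summand is c0.\<close>

definition two_ends_poly :: "nat \<Rightarrow> nat \<Rightarrow> nat \<Rightarrow> nat \<Rightarrow> rat poly" where
  "two_ends_poly d a b k =
     (let M = a + b + k in
      if d = 0 then qfact (M - 1) * qint (M + 2) * qint (a + b) * qint (b + k)
        + of_nat (M + 2) * two_ends_poly1 a b k - (of_nat ((M + 2) * M) - of_nat ((M + 2) choose 2)) * two_ends_poly2 a b k
      else if d = 1 then two_ends_poly1 a b k else if d = 2 then two_ends_poly2 a b k else 0)"

text \<open>
  Values at \<open>t\<close> of the two families as rational functions of \<open>x = t\<^sup>a\<close>, \<open>y = t\<^sup>b\<close>, \<open>z = t\<^sup>k\<close>, with the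
  \<open>t\<close>-factorials \<open>e, g, f\<close> and the clique size \<open>m\<close> as further variables. The recursions become rational
  identities in which \<open>a - 1\<close> is simply \<open>x / t\<close>, without case distinctions for empty blocks.
\<close>

definition one_end_val where
  "one_end_val d t x y g f m = (let Q = (\<lambda>w. (w - 1) / (t - 1)) in
     if d = (0::nat) then g * Q y * (Q (x * y * t) - (m + 1)) + (m + 1) * f
     else if d = 1 then y * Q x * g else (0::rat))"

definition two_ends_val2 where
  "two_ends_val2 t x y z e = (let Q = (\<lambda>w. (w - 1) / (t - 1)) in x * y^2 * z / t * (1 + t) * Q x * Q z * (e::rat))"
definition two_ends_val1 where
  "two_ends_val1 t x y z e g f m = (let Q = (\<lambda>w. (w - 1) / (t - 1)) in
    (x * y * (Q z * Q (y * z / t)) + y * z * t * (Q x * Q (x * y / t))) * (Q (x * y * z) - m) * e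
   + m * g * (x * y * Q z + y * z * t * Q x) + y * z * (f::rat))"
definition two_ends_val where
  "two_ends_val d t x y z e g f m = (let Q = (\<lambda>w. (w - 1) / (t - 1)) in
     if d = (0::nat) then g * Q (x * y * z * t^2) * Q (x * y) * Q (y * z) + (m + 2) * two_ends_val1 t x y z e g f m - ((m + 2) * m - (m + 2) * (m + 1) / 2) * two_ends_val2 t x y z e
     else if d = 1 then two_ends_val1 t x y z e g f m else if d = 2 then two_ends_val2 t x y z e
     else (0::rat))"

lemma poly_one_end_poly:
  assumes "t \<noteq> 1"
  shows "poly (one_end_poly d a b) t = one_end_val d t (t^a) (t^b) (poly (qfact (a+b-1)) t) (poly (qfact (a+b)) t) (of_nat (a + b))"
  using assms by (simp add: one_end_poly_def one_end_val_def Let_def poly_qint poly_power power_add ac_simps of_nat_poly)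

lemma of_nat_add_2_choose_2: "of_nat ((m + 2) choose 2) = (of_nat m + 2) * (of_nat m + 1) / (2 :: rat)"
  by (simp add: binomial_gbinomial gbinomial_prod_rev numeral_2_eq_2 field_simps)

lemma poly_two_ends_poly2:
  assumes "t \<noteq> 0" "t \<noteq> 1"
  shows "poly (two_ends_poly2 a b k) t = two_ends_val2 t (t^a) (t^b) (t^k) (poly (qfact (a+b+k-2)) t)"
proof (cases "a = 0")
  case True
  then show ?thesis using assms by (simp add: two_ends_poly2_def two_ends_val2_def poly_qint)
next
  case False
  then have "t ^ (a + 2 * b + k) = t * t ^ (a + 2 * b + k - 1)"
    by (cases a) simp_all
  then have *: "t ^ (a + 2 * b + k - 1) = t^a * (t^b)^2 * t^k / t"
    using assms by (simp add: power_add field_simps power_mult power2_eq_square)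
  have 2: "poly (qint 2) t = 1 + t" using assms by (simp add: qint_def numeral_2_eq_2 poly_sum)
  show ?thesis
    using assms by (simp add: two_ends_poly2_def two_ends_val2_def poly_qint poly_power * 2 Let_def del: One_nat_def)
qed

lemma poly_qint_pred: "t \<noteq> 0 \<Longrightarrow> t \<noteq> 1 \<Longrightarrow> k \<noteq> 0 \<Longrightarrow> poly (qint (k - 1)) t = (t ^ k / t - 1) / (t - 1)"
  by (cases k) (simp_all add: poly_qint)

lemma poly_two_ends_poly1:
  assumes "t \<noteq> 0" "t \<noteq> 1"
  shows "poly (two_ends_poly1 a b k) t = two_ends_val1 t (t^a) (t^b) (t^k) (poly (qfact (a+b+k-2)) t) (poly (qfact (a+b+k-1)) t)
     (poly (qfact (a+b+k)) t) (of_nat (a+b+k))"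
proof -
  have 1: "poly (qint k) t * poly (qint (b + k - 1)) t = (t^k - 1) / (t - 1) * ((t^b * t^k / t - 1) / (t - 1))"
    using assms poly_qint_pred[of t "b + k"] by (cases "k = 0") (simp_all add: poly_qint power_add del: One_nat_def)
  have 2: "poly (qint a) t * poly (qint (a + b - 1)) t = (t^a - 1) / (t - 1) * ((t^a * t^b / t - 1) / (t - 1))"
    using assms poly_qint_pred[of t "a + b"] by (cases "a = 0") (simp_all add: poly_qint power_add del: One_nat_def)
  show ?thesis
    unfolding two_ends_poly1_def two_ends_val1_def Let_def poly_add poly_mult poly_diff 1 2
    using assms by (simp add: poly_qint power_add of_nat_poly mult.left_commute[of t] mult.assoc mult.commute[of _ t] del: One_nat_def)
qed

lemma poly_two_ends_poly:
  assumes "t \<noteq> 0" "t \<noteq> 1"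
  shows "poly (two_ends_poly d a b k) t = two_ends_val d t (t^a) (t^b) (t^k) (poly (qfact (a+b+k-2)) t) (poly (qfact (a+b+k-1)) t)
     (poly (qfact (a+b+k)) t) (of_nat (a+b+k))"
proof -
  have 1: "poly (of_nat ((a + b + k + 2) * (a + b + k)) - of_nat ((a + b + k + 2) choose 2)) t =
      (of_nat (a + b + k) + 2) * of_nat (a + b + k) - (of_nat (a + b + k) + 2) * (of_nat (a + b + k) + 1) / 2"
    by (simp only: of_nat_poly poly_diff poly_pCons poly_0 mult_zero_right add_0_right of_nat_add_2_choose_2
         of_nat_mult of_nat_add of_nat_numeral)
  have 2: "poly (of_nat (a + b + k + 2)) t = of_nat (a + b + k) + 2"
    by (simp add: of_nat_poly)
  show ?thesis
    unfolding two_ends_poly_def two_ends_val_def Let_def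
    by (simp only: poly_diff[of _ "_ * _"] poly_add poly_mult 1 2 poly_two_ends_poly1[OF assms] poly_two_ends_poly2[OF assms] poly_qint[OF assms(2)] power_add
      poly_0 if_distrib[where f = "\<lambda>p. poly p t"])
qed

text \<open>Right-hand side of the recursion for a largest colour used once. The summands give this
  colour to vertex 1, to vertex n, and to a vertex of the first, middle and last block;
  \<open>e'\<close> is [M-3]!, needed because M drops by one.\<close>

definition two_ends_val_rec where
  "two_ends_val_rec d t x y z e' e g f m = (let Q = (\<lambda>w. (w - 1) / (t - 1)) in
     one_end_val d t x (y * z) g f m + y * z * one_end_val d t z (x * y) g f m
     + t * Q x * two_ends_val d t (x / t) y z e' e g (m - 1)
     + t * x * Q y * two_ends_val d t x (y / t) z e' e g (m - 1)
     + x * y * Q z * two_ends_val d t x y (z / t) e' e g (m - (1::rat)))"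

text \<open>Here x y z plays the role of t^M, and the hypothesis on \<open>e\<close> reads [M-2]! =
  [M-2] [M-3]!.\<close>

lemma two_ends_val_rec_2:
  assumes "t \<noteq> 0" "t \<noteq> 1"
    and "e = (x * y * z / t^2 - 1) / (t - 1) * e'"
  shows "two_ends_val_rec 2 t x y z e' e g f m = two_ends_val 2 t x y z e g f m"
proof -
  \<comment> \<open>With t - 1 as an atom, the denominators are products of s and t, and clearing
    them leaves a polynomial identity.\<close>
  define s where "s = t - 1"
  then have s: "s \<noteq> 0" "t = s + 1" using assms by auto
  show ?thesis using assms(1) s(1)
  unfolding two_ends_val_rec_def one_end_val_def two_ends_val_def two_ends_val2_def Let_def assms(3) s_def[symmetric]
  apply (simp add: divide_simps)
  unfolding s(2) by algebra
qed

lemma two_ends_val_rec_1: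
  assumes "t \<noteq> 0" "t \<noteq> 1"
    and "e = (x * y * z / t^2 - 1) / (t - 1) * e'" "g = (x * y * z / t - 1) / (t - 1) * e"
      "f = (x * y * z - 1) / (t - 1) * g"
  shows "two_ends_val_rec 1 t x y z e' e g f m = two_ends_val 1 t x y z e g f m"
proof -
  define s where "s = t - 1"
  then have s: "s \<noteq> 0" "t = s + 1" using assms by auto
  show ?thesis using assms(1) s(1)
  unfolding two_ends_val_rec_def one_end_val_def two_ends_val_def two_ends_val1_def Let_def assms(5) assms(4) assms(3) s_def[symmetric]
  apply (simp add: divide_simps)
  unfolding s(2) by algebra
qed


lemma two_ends_val_rec_0:
  assumes "t \<noteq> 0" "t \<noteq> 1"
    and "e = (x * y * z / t^2 - 1) / (t - 1) * e'" "g = (x * y * z / t - 1) / (t - 1) * e"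
      "f = (x * y * z - 1) / (t - 1) * g"
  shows "two_ends_val_rec 0 t x y z e' e g f m = two_ends_val 0 t x y z e g f m"
proof -
  define s where "s = t - 1"
  then have s: "s \<noteq> 0" "t = s + 1" using assms by auto
  show ?thesis using assms(1) s(1)
  unfolding two_ends_val_rec_def one_end_val_def two_ends_val_def two_ends_val1_def two_ends_val2_def Let_def assms(5) assms(4) assms(3) s_def[symmetric]
  apply (simp add: divide_simps)
  unfolding s(2) by algebra
qed

text \<open>At M = 2 the relation [M-2]! = [M-2] [M-3]! breaks down: [0] = 0, but [0]! = 1 and M - 3
  truncates. The actual factorials and x y z = t^2 are inserted instead. For d = 2 the four vertices
  would leave no colour used once.\<close>

lemma two_ends_val_rec_base:
  assumes "t \<noteq> 0" "t \<noteq> 1" "x \<noteq> 0" "y \<noteq> 0" "z = t^2 / (x * y)" "d < 2"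
  shows "two_ends_val_rec d t x y z 1 1 1 (1 + t) 2 = two_ends_val d t x y z 1 1 (1 + t) 2"
proof -
  define s where "s = t - 1"
  then have s: "s \<noteq> 0" "t = s + 1" using assms by auto
  from assms(6) consider "d = 0" | "d = 1" by linarith
  then show ?thesis
  proof cases
    case 1
    show ?thesis using assms(1) s(1) assms(3,4)
      unfolding 1 two_ends_val_rec_def one_end_val_def two_ends_val_def two_ends_val1_def two_ends_val2_def Let_def assms(5) s_def[symmetric]
      apply (simp add: divide_simps)
      unfolding s(2) by algebra
  next
    case 2
    show ?thesis using assms(1) s(1) assms(3,4)
      unfolding 2 two_ends_val_rec_def one_end_val_def two_ends_val_def two_ends_val1_def Let_def assms(5) s_def[symmetric]
      apply (simp add: divide_simps)
      unfolding s(2) by algebra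
  qed
qed

text \<open>The factor [a] absorbs the truncation in a - 1: both sides vanish for a = 0, and
  otherwise t^(a-1) = t^a / t. The same holds for b and k.\<close>

lemma poly_two_ends_poly_pred:
  fixes a b k d :: nat and t :: rat
  assumes t: "t \<noteq> 0" "t \<noteq> 1"
  defines "F \<equiv> \<lambda>j. poly (qfact j) t" and "Q \<equiv> \<lambda>w. (w - 1) / (t - 1)" and "M \<equiv> a + b + k"
  shows "poly (qint a * two_ends_poly d (a - 1) b k) t
      = Q (t^a) * two_ends_val d t (t^a / t) (t^b) (t^k) (F (M - 3)) (F (M - 2)) (F (M - 1)) (of_nat M - 1)"
    and "poly (qint b * two_ends_poly d a (b - 1) k) t
      = Q (t^b) * two_ends_val d t (t^a) (t^b / t) (t^k) (F (M - 3)) (F (M - 2)) (F (M - 1)) (of_nat M - 1)"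
    and "poly (qint k * two_ends_poly d a b (k - 1)) t
      = Q (t^k) * two_ends_val d t (t^a) (t^b) (t^k / t) (F (M - 3)) (F (M - 2)) (F (M - 1)) (of_nat M - 1)"
proof -
  have pred: "poly (two_ends_poly d a' b' k') t = two_ends_val d t (t^a') (t^b') (t^k')
      (F (M - 3)) (F (M - 2)) (F (M - 1)) (of_nat M - 1)" if "Suc (a' + b' + k') = M" for a' b' k'
  proof -
    have "a' + b' + k' - 2 = M - 3" "a' + b' + k' - 1 = M - 2" "a' + b' + k' = M - 1"
      "of_nat (a' + b' + k') = (of_nat M - 1 :: rat)"
      using that by auto
    then show ?thesis
      unfolding poly_two_ends_poly[OF t] F_def by simp
  qed
  show "poly (qint a * two_ends_poly d (a - 1) b k) t
      = Q (t^a) * two_ends_val d t (t^a / t) (t^b) (t^k) (F (M - 3)) (F (M - 2)) (F (M - 1)) (of_nat M - 1)"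
    using t pred[of "a - 1" b k] by (cases a) (auto simp: M_def Q_def poly_qint)
  show "poly (qint b * two_ends_poly d a (b - 1) k) t
      = Q (t^b) * two_ends_val d t (t^a) (t^b / t) (t^k) (F (M - 3)) (F (M - 2)) (F (M - 1)) (of_nat M - 1)"
    using t pred[of a "b - 1" k] by (cases b) (auto simp: M_def Q_def poly_qint)
  show "poly (qint k * two_ends_poly d a b (k - 1)) t
      = Q (t^k) * two_ends_val d t (t^a) (t^b) (t^k / t) (F (M - 3)) (F (M - 2)) (F (M - 1)) (of_nat M - 1)"
    using t pred[of a b "k - 1"] by (cases k) (auto simp: M_def Q_def poly_qint)
qed

text \<open>Of the M + 2 vertices, 2 d carry squared colours, so the hypothesis guarantees a colour
  used once. A vertex of the first two blocks gains a factor t from vertex 1 below it, one of the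
  last block does not.\<close>

lemma two_ends_poly_step:
  assumes "2 * d < a + b + k + 2"
  shows "two_ends_poly d a b k = one_end_poly d a (b + k) + [:0, 1:] ^ (b + k) * one_end_poly d k (a + b)
    + [:0, 1:] * (qint a * two_ends_poly d (a - 1) b k) + [:0, 1:] ^ Suc a * (qint b * two_ends_poly d a (b - 1) k)
    + [:0, 1:] ^ (a + b) * (qint k * two_ends_poly d a b (k - 1))" (is "_ = ?rhs")
proof -
  define M where "M = a + b + k"
  \<comment> \<open>The three factorial relations hold only from M = 3 on; M = 0 and M = 1 are
    computed outright, M = 2 has its own identity.\<close>
  consider "M = 0" | "M = 1" | "d > 2" | "M = 2" "d \<le> 2" | "M \<ge> 3" "d \<le> 2" by linarith
  then show ?thesis
  proof cases
    case 1
    with assms show ?thesis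
      by (auto simp: M_def two_ends_poly_def one_end_poly_def two_ends_poly1_def two_ends_poly2_def qint_def qfact_def)
  next
    case 2
    with assms consider "d = 0" | "d = 1" unfolding M_def by linarith
    moreover have "a = 1 \<and> b = 0 \<and> k = 0 \<or> a = 0 \<and> b = 1 \<and> k = 0 \<or> a = 0 \<and> b = 0 \<and> k = 1"
      using 2 unfolding M_def by linarith
    ultimately show ?thesis
      by cases (auto simp: two_ends_poly_def one_end_poly_def two_ends_poly1_def two_ends_poly2_def qint_def qfact_def
          numeral_2_eq_2 numeral_3_eq_3 of_nat_poly one_pCons)
  next
    case 3
    then show ?thesis by (simp add: two_ends_poly_def one_end_poly_def)
  next
    case M: 4
    with assms have d: "d < 2" by (simp add: M_def)
    have F: "qfact 0 = 1" "qfact 1 = 1" "qfact 2 = [:1, 1:]"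
      by (simp_all add: qfact_def qint_def numeral_2_eq_2 one_pCons)
    show ?thesis
    proof (rule rat_poly_eqI)
      fix t :: rat assume t: "t \<noteq> 0" "t \<noteq> 1"
      have "t ^ k = t\<^sup>2 / (t ^ a * t ^ b)"
        using t M(1) by (simp add: M_def field_simps flip: power_add)
      from two_ends_val_rec_base[OF t _ _ this d] t
      show "poly (two_ends_poly d a b k) t = poly ?rhs t"
        unfolding poly_add poly_mult[of "_ ^ _"] poly_mult[of "[:0, 1:]"] poly_two_ends_poly_pred[OF t] poly_one_end_poly[OF t(2)]
          poly_two_ends_poly[OF t]
        using M(1) F
        by (simp add: M_def two_ends_val_rec_def Let_def power_add add.assoc ac_simps)
    qed
  next
    case M: 5
    show ?thesis
    proof (rule rat_poly_eqI)
      fix t :: rat assume t: "t \<noteq> 0" "t \<noteq> 1"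
      define F where "F = (\<lambda>j. poly (qfact j) t)"
      obtain j where j: "M = Suc (Suc (Suc j))"
        using M(1) by (metis Suc_le_D numeral_3_eq_3 Suc_le_mono)
      have x: "t ^ a * t ^ b * t ^ k = t * t * t * t ^ j"
        using j by (simp add: M_def flip: power_add)
      have F: "F (M - 2) = (t ^ a * t ^ b * t ^ k / t\<^sup>2 - 1) / (t - 1) * F (M - 3)"
        "F (M - 1) = (t ^ a * t ^ b * t ^ k / t - 1) / (t - 1) * F (M - 2)"
        "F M = (t ^ a * t ^ b * t ^ k - 1) / (t - 1) * F (M - 1)"
        unfolding x F_def using t by (simp_all add: j qfact_Suc poly_qint power2_eq_square)
      have "two_ends_val_rec d t (t ^ a) (t ^ b) (t ^ k) (F (M - 3)) (F (M - 2)) (F (M - 1)) (F M) (of_nat M)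
          = two_ends_val d t (t ^ a) (t ^ b) (t ^ k) (F (M - 2)) (F (M - 1)) (F M) (of_nat M)"
        using two_ends_val_rec_0[OF t F] two_ends_val_rec_1[OF t F] two_ends_val_rec_2[OF t F(1)] M(2)
        by (metis One_nat_def le_Suc_eq le_zero_eq numeral_2_eq_2)
      then show "poly (two_ends_poly d a b k) t = poly ?rhs t"
        unfolding poly_add poly_mult[of "_ ^ _"] poly_mult[of "[:0, 1:]"] poly_two_ends_poly_pred[OF t] poly_one_end_poly[OF t(2)]
          poly_two_ends_poly[OF t] two_ends_val_rec_def Let_def
        by (simp add: F_def M_def power_add ac_simps)
    qed
  qed
qed


section \<open>Recursions with one end vertex, and for a largest colour used twice\<close>

lemma qint_0 [simp]: "qint 0 = 0"
  by (simp add: qint_def)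

lemma qint_add: "qint (a + b) = qint a + [:0, 1:] ^ a * qint b"
proof (induction b)
  case (Suc b)
  then show ?case by (simp add: qint_def power_add algebra_simps)
qed simp

text \<open>The first recursion belongs to the clique with n attached, the second to the clique with
  1 attached: there the end vertex has weight 1, and each of its neighbours gains a factor t. As one
  function solves both, the two graphs can share \<open>one_end_poly\<close>, whose first size
  counts the nonneighbours of the end vertex.\<close>

lemma one_end_val_rec:
  assumes "t \<noteq> 0" "t \<noteq> 1" "d \<le> 1"
    and "g = (x * y / t - 1) / (t - 1) * e" "f = (x * y - 1) / (t - 1) * g"
  shows "one_end_val d t x y g f m = (x - 1) / (t - 1) * one_end_val d t (x / t) y e g (m - 1)
      + x * ((y - 1) / (t - 1) * one_end_val d t x (y / t) e g (m - 1)) + y * (if d = 0 then f else 0)"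
    and "one_end_val d t x y g f m = (if d = 0 then f else 0)
      + t * ((y - 1) / (t - 1) * one_end_val d t x (y / t) e g (m - 1))
      + y * ((x - 1) / (t - 1) * one_end_val d t (x / t) y e g (m - 1))"
proof -
  define s where "s = t - 1"
  then have s: "s \<noteq> 0" "t = s + 1" using assms by auto
  from assms(3) consider "d = 0" | "d = 1" by linarith
  note d = this
  show "one_end_val d t x y g f m = (x - 1) / (t - 1) * one_end_val d t (x / t) y e g (m - 1)
      + x * ((y - 1) / (t - 1) * one_end_val d t x (y / t) e g (m - 1)) + y * (if d = 0 then f else 0)"
  proof (cases rule: d)
    case 1
    show ?thesis using assms(1) s(1)
      unfolding 1 one_end_val_def Let_def assms(5) assms(4) s_def[symmetric]
      apply (simp add: divide_simps)
      unfolding s(2) by algebra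
  next
    case 2
    show ?thesis using assms(1) s(1)
      unfolding 2 one_end_val_def Let_def assms(5) assms(4) s_def[symmetric]
      apply (simp add: divide_simps)
      unfolding s(2) by algebra
  qed
  show "one_end_val d t x y g f m = (if d = 0 then f else 0)
      + t * ((y - 1) / (t - 1) * one_end_val d t x (y / t) e g (m - 1))
      + y * ((x - 1) / (t - 1) * one_end_val d t (x / t) y e g (m - 1))"
  proof (cases rule: d)
    case 1
    show ?thesis using assms(1) s(1)
      unfolding 1 one_end_val_def Let_def assms(5) assms(4) s_def[symmetric]
      apply (simp add: divide_simps)
      unfolding s(2) by algebra
  next
    case 2
    show ?thesis using assms(1) s(1)
      unfolding 2 one_end_val_def Let_def assms(5) assms(4) s_def[symmetric]
      apply (simp add: divide_simps)
      unfolding s(2) by algebra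
  qed
qed

lemma poly_one_end_poly_pred:
  fixes a b d :: nat and t :: rat
  assumes t: "t \<noteq> 0" "t \<noteq> 1"
  defines "F \<equiv> \<lambda>j. poly (qfact j) t" and "Q \<equiv> \<lambda>w. (w - 1) / (t - 1)" and "M \<equiv> a + b"
  shows "poly (qint a * one_end_poly d (a - 1) b) t
      = Q (t^a) * one_end_val d t (t^a / t) (t^b) (F (M - 2)) (F (M - 1)) (of_nat M - 1)"
    and "poly (qint b * one_end_poly d a (b - 1)) t
      = Q (t^b) * one_end_val d t (t^a) (t^b / t) (F (M - 2)) (F (M - 1)) (of_nat M - 1)"
proof -
  have pred: "poly (one_end_poly d a' b') t = one_end_val d t (t^a') (t^b') (F (M - 2)) (F (M - 1)) (of_nat M - 1)"
    if "Suc (a' + b') = M" for a' b'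
  proof -
    have "a' + b' - 1 = M - 2" "a' + b' = M - 1" "of_nat (a' + b') = (of_nat M - 1 :: rat)"
      using that by auto
    then show ?thesis
      unfolding poly_one_end_poly[OF t(2)] F_def by simp
  qed
  show "poly (qint a * one_end_poly d (a - 1) b) t
      = Q (t^a) * one_end_val d t (t^a / t) (t^b) (F (M - 2)) (F (M - 1)) (of_nat M - 1)"
    using t pred[of "a - 1" b] by (cases a) (auto simp: M_def Q_def poly_qint)
  show "poly (qint b * one_end_poly d a (b - 1)) t
      = Q (t^b) * one_end_val d t (t^a) (t^b / t) (F (M - 2)) (F (M - 1)) (of_nat M - 1)"
    using t pred[of a "b - 1"] by (cases b) (auto simp: M_def Q_def poly_qint)
qed

lemma one_end_poly_step:
  assumes "2 * d < a + b + 1"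
  shows "one_end_poly d a b = qint a * one_end_poly d (a - 1) b + [:0, 1:] ^ a * (qint b * one_end_poly d a (b - 1))
      + [:0, 1:] ^ b * (if d = 0 then qfact (a + b) else 0)" (is "_ = ?r1")
    and "one_end_poly d a b = (if d = 0 then qfact (a + b) else 0)
      + [:0, 1:] * (qint b * one_end_poly d a (b - 1)) + [:0, 1:] ^ b * (qint a * one_end_poly d (a - 1) b)" (is "_ = ?r2")
proof -
  define M where "M = a + b"
  have "one_end_poly d a b = ?r1 \<and> one_end_poly d a b = ?r2"
  proof -
    \<comment> \<open>The relation [M-1]! = [M-1] [M-2]! fails at M = 1, where the left side is 1
      and [0] = 0.\<close>
    consider "M = 0" | "M = 1" | "M \<ge> 2" "d \<le> 1" | "d > 1" by linarith
    then show ?thesis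
    proof cases
      case 1
      with assms show ?thesis
        by (simp add: M_def one_end_poly_def)
    next
      case 2
      then have "a = 1 \<and> b = 0 \<or> a = 0 \<and> b = 1" "d = 0"
        using assms unfolding M_def by linarith+
      then show ?thesis
        by (auto simp: one_end_poly_def qint_def qfact_def of_nat_poly one_pCons numeral_2_eq_2)
    next
      case M: 3
      have "poly (one_end_poly d a b) t = poly ?r1 t \<and> poly (one_end_poly d a b) t = poly ?r2 t" if t: "t \<noteq> 0" "t \<noteq> 1" for t
      proof -
        define F where "F = (\<lambda>j. poly (qfact j) t)"
        obtain j where j: "M = Suc (Suc j)"
          using M(1) by (metis Suc_le_D numeral_2_eq_2 Suc_le_mono)
        have x: "t ^ a * t ^ b = t * t * t ^ j"
          using j by (simp add: M_def flip: power_add)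
        have F: "F (M - 1) = (t ^ a * t ^ b / t - 1) / (t - 1) * F (M - 2)"
          "F M = (t ^ a * t ^ b - 1) / (t - 1) * F (M - 1)"
          unfolding x F_def using t by (simp_all add: j qfact_Suc poly_qint)
        have pif: "poly (if d = 0 then qfact (a + b) else 0) t = (if d = 0 then F M else 0)"
          by (simp add: F_def M_def)
        show ?thesis
          using one_end_val_rec[OF t M(2) F, of "of_nat M"]
          unfolding poly_add poly_mult[of "_ ^ _"] poly_mult[of "[:0, 1:]"] poly_one_end_poly_pred[OF t] poly_one_end_poly[OF t(2)] pif
          by (simp add: F_def M_def)
      qed
      then show ?thesis
        by (intro conjI rat_poly_eqI) blast+
    next
      case 4
      then show ?thesis by (simp add: one_end_poly_def)
    qed
  qed
  then show "one_end_poly d a b = ?r1" "one_end_poly d a b = ?r2" by blast+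
qed

text \<open>Recursion for a largest colour used twice, with classes {1, n}, {1, v}, {u, n} in this
  order. Together with \<open>two_ends_poly_step\<close> it makes the relative order of squared and
  simple colours irrelevant.\<close>

lemma two_ends_poly_pair:
  assumes "d \<ge> 1"
  shows "two_ends_poly d a b k = [:0, 1:] ^ (b + k) * (if d = 1 then qfact (a + b + k) else 0)
    + [:0, 1:] ^ (a + b) * (qint k * one_end_poly (d - 1) a (b + k - 1))
    + [:0, 1:] ^ (b + k + 1) * (qint a * one_end_poly (d - 1) k (a + b - 1))"
proof -
  consider "d = 1" | "d = 2" | "d > 2" using assms by linarith
  then show ?thesis
  proof cases
    case 1
    have p1: "qint k * one_end_poly 0 a (b + k - 1) = qint k * (qfact (a + b + k - 2) * qint (b + k - 1) * (qint (a + b + k) - of_nat (a + b + k))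
        + of_nat (a + b + k) * qfact (a + b + k - 1))"
      by (cases k) (simp_all add: one_end_poly_def add.assoc)
    have p2: "qint a * one_end_poly 0 k (a + b - 1) = qint a * (qfact (a + b + k - 2) * qint (a + b - 1) * (qint (a + b + k) - of_nat (a + b + k))
        + of_nat (a + b + k) * qfact (a + b + k - 1))"
      by (cases a) (simp_all add: one_end_poly_def ac_simps)
    have p3: "two_ends_poly 1 a b k = two_ends_poly1 a b k" by (simp add: two_ends_poly_def)
    show ?thesis
      unfolding 1 diff_self_eq_0 p1 p2 p3 two_ends_poly1_def diff_self_eq_0 if_P[OF refl] by (simp only: algebra_simps)
  next
    case 2
    show ?thesis
    proof (cases "a = 0 \<or> k = 0")
      case True
      then show ?thesis using 2 by (auto simp: one_end_poly_def two_ends_poly_def two_ends_poly2_def)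
    next
      case False
      then obtain a' k' where ak: "a = Suc a'" "k = Suc k'" by (metis not0_implies_Suc)
      \<comment> \<open>The two products carry t^(a+2b+k-1) and t^(a+2b+k); together they produce
        the factor [2].\<close>
      have q: "qint 2 = 1 + [:0, 1:]" by (simp add: qint_def numeral_2_eq_2)
      define T :: "rat poly" where "T = [:0, 1:]"
      show ?thesis
        unfolding ak 2 using ak
        unfolding one_end_poly_def two_ends_poly_def two_ends_poly2_def q T_def[symmetric]
        by (simp add: algebra_simps power_add mult_2_right)
    qed
  next
    case 3
    then show ?thesis by (simp add: one_end_poly_def two_ends_poly_def)
  qed
qed


section \<open>The e-coefficients in factored form\<close>

text \<open>This is c1 + (n-2) c2 with [n-4]! taken out, for a = i + 1, k = j + 1, M = n - 2. The
  terms with the factor M collapse to M c2 because [M-1] - [b+k-1] = t^(b+k-1) [a], and similarly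
  with a and k exchanged. What is left is [M] (t^(a+b) [k] [b+k-1] + t^(b+k+1) [a] [a+b-1] + t^(b+k)
  [M-1]). It equals its mirror image under exchange of a and k; the factor 1/2 comes from taking the
  mean of the two.\<close>

lemma two_ends_poly1_expand:
  "two_ends_poly1 (Suc i) b (Suc j) = qfact (i + b + j) *
     (smult (1 / 2) (qint (i + b + j + 2) *
        (([:0, 1:] ^ (i + b + 1) + [:0, 1:] ^ (b + j + 1)) * qint (i + b + j + 1)
         + [:0, 1:] ^ (b + j + 1) * qint 2 * qint (i + b) * qint (i + 1)
         + [:0, 1:] ^ (i + b + 1) * qint 2 * qint (j + 1) * qint (b + j)))
      + of_nat (i + b + j + 2) * ([:0, 1:] ^ (i + 2 * b + j + 1) * qint 2 * qint (j + 1) * qint (i + 1)))"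
  (is "_ = ?rhs")
proof (rule rat_poly_eqI)
  fix t :: rat assume t: "t \<noteq> 0" "t \<noteq> 1"
  define h where "h = poly (qfact (i + b + j)) t"
  define s where "s = t - 1"
  then have s: "s \<noteq> 0" "t = s + 1" using t by auto
  define x y z m where "x = t ^ i" and "y = t ^ b" and "z = t ^ j" and "m = (of_nat (i + b + j + 2) :: rat)"
  have F: "poly (qfact (Suc i + b + Suc j - 2)) t = h"
    "poly (qfact (Suc i + b + Suc j - 1)) t = (t * (x * y * z) - 1) / (t - 1) * h"
    "poly (qfact (Suc i + b + Suc j)) t
      = (t * (t * (x * y * z)) - 1) / (t - 1) * ((t * (x * y * z) - 1) / (t - 1) * h)"
    using t by (simp_all add: qfact_Suc poly_qint h_def x_def y_def z_def power_add)
  have m: "of_nat (Suc i + b + Suc j) = m" by (simp add: m_def)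
  have q2: "(t\<^sup>2 - 1) / (t - 1) = 1 + t" using t by (simp add: field_simps power2_eq_square)
  have L: "poly (two_ends_poly1 (Suc i) b (Suc j)) t = two_ends_val1 t (t * x) y (t * z) h ((t * (x * y * z) - 1) / (t - 1) * h)
     ((t * (t * (x * y * z)) - 1) / (t - 1) * ((t * (x * y * z) - 1) / (t - 1) * h)) m"
    unfolding poly_two_ends_poly1[OF t] F m by (simp add: x_def y_def z_def)
  have R: "poly ?rhs t = h * ((1 / 2) * ((t^2 * (x * y * z) - 1) / (t - 1) *
        ((t * x * y + t * y * z) * ((t * (x * y * z) - 1) / (t - 1))
         + t * y * z * (1 + t) * ((x * y - 1) / (t - 1)) * ((t * x - 1) / (t - 1))
         + t * x * y * (1 + t) * ((t * z - 1) / (t - 1)) * ((y * z - 1) / (t - 1))))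
       + m * (t * x * y * y * z * (1 + t) * ((t * z - 1) / (t - 1)) * ((t * x - 1) / (t - 1))))"
  proof -
    have pm: "poly (of_nat (i + b + j + 2)) t = m"
      unfolding m_def by (simp add: of_nat_poly)
    have pw: "t ^ (i + b + 1) = t * x * y" "t ^ (b + j + 1) = t * y * z" "t ^ (i + b + j + 1) = t * (x * y * z)"
      "t ^ (i + b + j + 2) = t^2 * (x * y * z)" "t ^ (i + 2 * b + j + 1) = t * x * y * y * z"
      "t ^ (i + b) = x * y" "t ^ (b + j) = y * z" "t ^ (i + 1) = t * x" "t ^ (j + 1) = t * z"
      by (simp_all add: x_def y_def z_def power_add mult_2 power2_eq_square)
    have pT: "poly [:0, 1:] t = t" by simp
    show ?thesis
      unfolding poly_mult poly_add poly_smult poly_power poly_qint[OF t(2)] pm pT pw q2 h_def by (rule refl)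
  qed
  show "poly (two_ends_poly1 (Suc i) b (Suc j)) t = poly ?rhs t"
    using t(1) s(1) unfolding L R two_ends_val1_def Let_def s_def[symmetric]
    apply (simp add: divide_simps)
    unfolding s(2) by algebra
qed

lemma pboth0_expand:
  "two_ends_poly 0 (Suc i) b (Suc j) =
     qfact (i + b + j) * (qint (i + b + j + 4) * qint (i + b + j + 1) * qint (i + b + 1) * qint (b + j + 1))
     + of_nat (i + b + j + 4) * two_ends_poly1 (Suc i) b (Suc j)
     - (of_nat ((i + b + j + 4) * (i + b + j + 2)) - of_nat ((i + b + j + 4) choose 2)) * two_ends_poly2 (Suc i) b (Suc j)"
proof -
  have e1: "Suc i + b + Suc j = i + b + j + 2" by simp
  have e: "i + b + j + 2 + 2 = i + b + j + 4"
    "Suc i + b = i + b + 1" "b + Suc j = b + j + 1" "i + b + j + 2 - 1 = Suc (i + b + j)" "i + b + j + 1 = Suc (i + b + j)"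
    by simp_all
  show ?thesis
    unfolding two_ends_poly_def Let_def e1 unfolding e qfact_Suc if_P[OF refl] by (simp only: mult_ac)
qed

lemma two_ends_poly2_expand:
  "two_ends_poly2 (Suc i) b (Suc j) =
     qfact (i + b + j) * ([:0, 1:] ^ (i + 2 * b + j + 1) * qint 2 * qint (j + 1) * qint (i + 1))"
  by (simp add: two_ends_poly2_def mult_ac)

subsection \<open>Palindromic unimodal polynomials\<close>

text \<open>The number d is twice the centre of symmetry, not the degree: p may be divisible by t.
  The zero polynomial fits every d, so vanishing summands never disturb a common centre.\<close>

definition sym_unimodal :: "nat \<Rightarrow> rat poly \<Rightarrow> bool" where
  "sym_unimodal d p \<longleftrightarrow> (\<forall>i. 0 \<le> coeff p i) \<and> (\<forall>i\<le>d. coeff p (d - i) = coeff p i) \<and>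
     (\<forall>i>d. coeff p i = 0) \<and> (\<forall>i. 2 * i < d \<longrightarrow> coeff p i \<le> coeff p (Suc i))"

lemma sym_unimodal_0: "sym_unimodal d 0"
  by (simp add: sym_unimodal_def)

lemma sym_unimodal_1: "sym_unimodal 0 1"
  by (simp add: sym_unimodal_def)

lemma sym_unimodal_add: "sym_unimodal d p \<Longrightarrow> sym_unimodal d q \<Longrightarrow> sym_unimodal d (p + q)"
  by (simp add: sym_unimodal_def add_mono)

lemma sym_unimodal_smult: "sym_unimodal d p \<Longrightarrow> 0 \<le> c \<Longrightarrow> sym_unimodal d (smult c p)"
  by (simp add: sym_unimodal_def mult_left_mono)

lemma coeff_pow_mult: "coeff ([:0, 1:] ^ k * p) i = (if k \<le> i then coeff p (i - k) else (0 :: rat))"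
  using coeff_monom_mult[of 1 k p i] by (simp add: monom_altdef)

lemma sym_unimodal_pow_mult:
  assumes "sym_unimodal d p"
  shows "sym_unimodal (d + 2 * k) ([:0, 1:] ^ k * p)"
proof -
  have pN: "\<And>i. 0 \<le> coeff p i" and pS: "\<And>i. i \<le> d \<Longrightarrow> coeff p (d - i) = coeff p i"
    and pZ: "\<And>i. i > d \<Longrightarrow> coeff p i = 0" and pM: "\<And>i. 2 * i < d \<Longrightarrow> coeff p i \<le> coeff p (Suc i)"
    using assms by (auto simp: sym_unimodal_def)
  show ?thesis
  unfolding sym_unimodal_def coeff_pow_mult
proof (intro conjI allI impI)
  fix i
  show "0 \<le> (if k \<le> i then coeff p (i - k) else 0)" using pN by simp
  show "(if k \<le> i then coeff p (i - k) else 0) = 0" if "i > d + 2 * k"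
    using pZ[of "i - k"] that by simp
  show "(if k \<le> d + 2 * k - i then coeff p (d + 2 * k - i - k) else 0) = (if k \<le> i then coeff p (i - k) else 0)"
    if "i \<le> d + 2 * k"
  proof (cases "k \<le> i \<and> i \<le> d + k")
    case True
    then have "d + 2 * k - i - k = d - (i - k)" "i - k \<le> d" by auto
    then have "coeff p (d + 2 * k - i - k) = coeff p (i - k)" by (simp only: pS)
    then show ?thesis using True by auto
  next
    case False
    then consider "i < k" | "i > d + k" by linarith
    then show ?thesis
    proof cases
      case 1
      then have "d + 2 * k - i - k > d" by linarith
      then have "coeff p (d + 2 * k - i - k) = 0" by (rule pZ)
      then show ?thesis using 1 by simp
    next
      case 2
      then have "coeff p (i - k) = 0" by (intro pZ) simp
      moreover have "\<not> k \<le> d + 2 * k - i" using 2 that by linarith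
      ultimately show ?thesis by simp
    qed
  qed
  assume i: "2 * i < d + 2 * k"
  show "(if k \<le> i then coeff p (i - k) else 0) \<le> (if k \<le> Suc i then coeff p (Suc i - k) else 0)"
  proof (cases "k \<le> i")
    case True
    then have "2 * (i - k) < d" using i by linarith
    then show ?thesis using pM[of "i - k"] True by (simp add: Suc_diff_le)
  next
    case False
    then show ?thesis using pN by simp
  qed
qed
qed

text \<open>The two inequalities say that j is at least as near to the centre d / 2 as i; an index j
  beyond the centre is reflected to d - j.\<close>

lemma sym_unimodal_mono:
  assumes "sym_unimodal d p" "i \<le> j" "i + j \<le> d"
  shows "coeff p i \<le> coeff p j"
proof -
  have pN: "\<And>i. 0 \<le> coeff p i" and pS: "\<And>i. i \<le> d \<Longrightarrow> coeff p (d - i) = coeff p i"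
    and pZ: "\<And>i. i > d \<Longrightarrow> coeff p i = 0" and pM: "\<And>i. 2 * i < d \<Longrightarrow> coeff p i \<le> coeff p (Suc i)"
    using assms by (auto simp: sym_unimodal_def)
  have left: "coeff p i \<le> coeff p l" if "i \<le> l" "2 * l \<le> d + 1" for l
    using that
  proof (induction l rule: dec_induct)
    case (step l)
    then have "coeff p l \<le> coeff p (Suc l)" by (intro pM) simp
    then show ?case using step by auto
  qed simp
  show ?thesis
  proof (cases "2 * j \<le> d + 1")
    case True
    then show ?thesis using left assms by simp
  next
    case False
    have "coeff p j = coeff p (d - j)" using pS[of j] assms(3) by simp
    then show ?thesis using left[of "d - j"] assms False by simp
  qed
qed

text \<open>Coefficient i of the product is a sum over a window of k + 1 consecutive coefficients of
  p. Passing to i + 1 gains index i + 1 and loses index i - k; for 2 i < d + k the gained one is at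
  least as near to d / 2.\<close>

lemma sym_unimodal_qint_mult:
  assumes "sym_unimodal d p"
  shows "sym_unimodal (d + k) (qint (Suc k) * p)"
proof -
  have pN: "\<And>i. 0 \<le> coeff p i" and pS: "\<And>i. i \<le> d \<Longrightarrow> coeff p (d - i) = coeff p i"
    and pZ: "\<And>i. i > d \<Longrightarrow> coeff p i = 0" and pM: "\<And>i. 2 * i < d \<Longrightarrow> coeff p i \<le> coeff p (Suc i)"
    using assms by (auto simp: sym_unimodal_def)
  \<comment> \<open>Extension by zero to negative indices, so that the window may stick out on the
    left.\<close>
  define c where "c m = (if 0 \<le> m then coeff p (nat m) else 0)" for m :: int
  have c_nonneg: "0 \<le> c m" for m using pN by (simp add: c_def)
  have c_sym: "c m = c (int d - m)" for m
  proof (cases "0 \<le> m \<and> m \<le> int d")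
    case True
    then have "nat (int d - m) = d - nat m" "nat m \<le> d" by auto
    then show ?thesis using pS[of "nat m"] True unfolding c_def by simp
  next
    case False
    then consider "m < 0" | "m > int d" by linarith
    then show ?thesis
    proof cases
      case 1
      then have "nat (int d - m) > d" by linarith
      then have "coeff p (nat (int d - m)) = 0" by (rule pZ)
      then show ?thesis using 1 by (simp add: c_def)
    next
      case 2
      then have "nat m > d" by linarith
      then have "coeff p (nat m) = 0" by (rule pZ)
      then show ?thesis using 2 by (simp add: c_def)
    qed
  qed
  have c_mono: "c l \<le> c m" if "l \<le> m" "l + m \<le> int d" for l m
  proof (cases "0 \<le> l")
    case True
    then have "coeff p (nat l) \<le> coeff p (nat m)"
      using that by (intro sym_unimodal_mono[OF assms]) auto
    then show ?thesis using True that by (simp add: c_def)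
  next
    case False
    then show ?thesis using c_nonneg[of m] by (simp add: c_def)
  qed
  have co: "coeff (qint (Suc k) * p) i = (\<Sum>j<Suc k. c (int i - int j))" for i
  proof -
    have "coeff (qint (Suc k) * p) i = (\<Sum>j<Suc k. coeff ([:0, 1:] ^ j * p) i)"
      unfolding qint_def sum_distrib_right coeff_sum ..
    also have "\<dots> = (\<Sum>j<Suc k. c (int i - int j))"
      unfolding coeff_pow_mult c_def by (intro sum.cong) (auto simp: nat_diff_distrib)
    finally show ?thesis .
  qed
  show ?thesis
    unfolding sym_unimodal_def
  proof (intro conjI allI impI)
    fix i
    show "0 \<le> coeff (qint (Suc k) * p) i"
      unfolding co by (intro sum_nonneg c_nonneg)
    show "coeff (qint (Suc k) * p) (d + k - i) = coeff (qint (Suc k) * p) i" if "i \<le> d + k"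
    proof -
      have "(\<Sum>j<Suc k. c (int i - int j)) = (\<Sum>j<Suc k. c (int i - int (Suc k - Suc j)))"
        by (rule sum.nat_diff_reindex[symmetric])
      also have "\<dots> = (\<Sum>j<Suc k. c (int (d + k - i) - int j))"
      proof (rule sum.cong)
        fix j assume "j \<in> {..<Suc k}"
        then have "int d - (int i - int (Suc k - Suc j)) = int (d + k - i) - int j"
          using that by auto
        then show "c (int i - int (Suc k - Suc j)) = c (int (d + k - i) - int j)"
          using c_sym[of "int i - int (Suc k - Suc j)"] by simp
      qed simp
      finally show ?thesis unfolding co by (rule sym)
    qed
    show "coeff (qint (Suc k) * p) i = 0" if "i > d + k"
    proof -
      have "c (int i - int j) = 0" if "j < Suc k" for j
        using c_sym[of "int i - int j"] that \<open>i > d + k\<close> by (simp add: c_def)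
      then show ?thesis unfolding co by simp
    qed
    assume i: "2 * i < d + k"
    have "(\<Sum>j<Suc k. c (int i - int j)) = (\<Sum>j<k. c (int i - int j)) + c (int i - int k)"
      by simp
    also have "\<dots> \<le> (\<Sum>j<k. c (int i - int j)) + c (int (Suc i))"
      using i by (intro add_left_mono c_mono) auto
    also have "\<dots> = (\<Sum>j<Suc k. c (int (Suc i) - int j))"
      by (simp only: sum.lessThan_Suc_shift) simp
    finally show "coeff (qint (Suc k) * p) i \<le> coeff (qint (Suc k) * p) (Suc i)"
      unfolding co .
  qed
qed

lemma sym_unimodal_qint: "sym_unimodal k (qint (Suc k))"
  using sym_unimodal_qint_mult[OF sym_unimodal_1, of k] by simp

lemma sym_unimodal_qfact_mult:
  assumes "sym_unimodal d p"
  shows "sym_unimodal ((k choose 2) + d) (qfact k * p)"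
proof (induction k)
  case 0
  then show ?case using assms by (simp add: qfact_def numeral_2_eq_2)
next
  case (Suc k)
  have "Suc k choose 2 = k + (k choose 2)" by (simp add: numeral_2_eq_2)
  then show ?case
    using sym_unimodal_qint_mult[OF Suc.IH, of k] by (simp add: qfact_Suc mult.assoc ac_simps)
qed

text \<open>The exponent intervals starting at i and j, both of length m, exchange their right ends;
  the hypotheses keep the new lengths nonnegative. The new intervals are concentric, whereas t^i [m]
  and t^j [m] have different centres unless i = j. This is what makes the sum palindromic and
  unimodal.\<close>

lemma pow_add_pow_mult_qint:
  assumes "i \<le> m + j" "j \<le> m + i"
  shows "([:0, 1:] ^ i + [:0, 1:] ^ j) * qint m = [:0, 1:] ^ i * qint (m + j - i) + [:0, 1:] ^ j * qint (m + i - j)"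
proof -
  have *: "([:0, 1:] ^ i + [:0, 1:] ^ j) * qint m = [:0, 1:] ^ i * qint (m + j - i) + [:0, 1:] ^ j * qint (m + i - j)"
    if "i \<le> j" "j \<le> m + i" for i j
  proof -
    define l h where "l = j - i" and "h = m - l"
    then have l: "j = i + l" and h: "m = l + h" using that by auto
    have 1: "m + j - i = l + m" "m + i - j = h" using l h by auto
    have 2: "qint m = qint l + [:0, 1:] ^ l * qint h" using h qint_add by simp
    have 3: "qint (l + m) = qint l + [:0, 1:] ^ l * qint m" by (rule qint_add)
    show ?thesis unfolding 1 3 unfolding 2 l power_add by (simp only: algebra_simps)
  qed
  show ?thesis
    using *[of i j] *[of j i] assms by (cases "i \<le> j") (simp_all add: add.commute)
qed


subsection \<open>Removing the largest colour\<close>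

definition colorings :: "nat set \<Rightarrow> (nat \<Rightarrow> nat \<Rightarrow> bool) \<Rightarrow> (nat \<Rightarrow> nat) \<Rightarrow> (nat \<Rightarrow> nat) set" where
  "colorings V E \<alpha> = {\<kappa>. \<kappa> \<in> V \<rightarrow>\<^sub>E UNIV \<and> proper_col V E \<kappa> \<and> (\<forall>c. card {v \<in> V. \<kappa> v = c} = \<alpha> c)}"

lemma chrom_qsf_colorings: "chrom_qsf V E \<alpha> = (\<Sum>\<kappa>\<in>colorings V E \<alpha>. [:0, 1:] ^ asc V E \<kappa>)"
  by (simp add: chrom_qsf_def colorings_def)

lemma coloring_in_support:
  assumes "finite V" "\<kappa> \<in> colorings V E \<alpha>" "v \<in> V"
  shows "\<alpha> (\<kappa> v) \<noteq> 0"
proof -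
  have "card {w \<in> V. \<kappa> w = \<kappa> v} = \<alpha> (\<kappa> v)"
    using assms by (auto simp: colorings_def)
  moreover have "v \<in> {w \<in> V. \<kappa> w = \<kappa> v}"
    using assms by auto
  ultimately show ?thesis
    using assms(1) by (metis (no_types, lifting) card_0_eq empty_iff finite_subset mem_Collect_eq subsetI)
qed

lemma finite_colorings:
  assumes "finite V" "finite {c. \<alpha> c \<noteq> 0}"
  shows "finite (colorings V E \<alpha>)"
proof (rule finite_subset)
  show "colorings V E \<alpha> \<subseteq> V \<rightarrow>\<^sub>E {c. \<alpha> c \<noteq> 0}"
    using coloring_in_support[OF assms(1), of _ E \<alpha>] by (auto simp: PiE_iff colorings_def extensional_def)
  show "finite (V \<rightarrow>\<^sub>E {c. \<alpha> c \<noteq> 0})"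
    using assms by (intro finite_PiE) auto
qed

definition indep_sets :: "nat set \<Rightarrow> (nat \<Rightarrow> nat \<Rightarrow> bool) \<Rightarrow> nat \<Rightarrow> nat set set" where
  "indep_sets V E k = {C. C \<subseteq> V \<and> card C = k \<and> (\<forall>i\<in>C. \<forall>j\<in>C. \<not> E i j)}"

text \<open>When C is the class of the largest colour, these are exactly the ascents that end in
  C.\<close>

definition edges_into :: "nat set \<Rightarrow> (nat \<Rightarrow> nat \<Rightarrow> bool) \<Rightarrow> nat set \<Rightarrow> nat" where
  "edges_into V E C = card {(i, j). i \<in> V - C \<and> j \<in> C \<and> i < j \<and> E i j}"

lemma asc_insert_top:
  assumes "finite V" "C \<subseteq> V" "\<And>i. i \<in> V - C \<Longrightarrow> \<kappa> i < c" "\<And>i. i \<in> C \<Longrightarrow> \<kappa> i = c"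
    "\<And>i. i \<in> V - C \<Longrightarrow> \<kappa>' i = \<kappa> i"
  shows "asc V E \<kappa> = edges_into V E C + asc (V - C) E \<kappa>'"
proof -
  let ?A = "{(i, j). i \<in> V - C \<and> j \<in> C \<and> i < j \<and> E i j}"
  let ?B = "{(i, j). i \<in> V - C \<and> j \<in> V - C \<and> i < j \<and> E i j \<and> \<kappa>' i < \<kappa>' j}"
  have "{(i, j). i \<in> V \<and> j \<in> V \<and> i < j \<and> E i j \<and> \<kappa> i < \<kappa> j} = ?A \<union> ?B"
  proof (rule set_eqI)
    fix p :: "nat \<times> nat"
    obtain i j where p: "p = (i, j)" by force
    show "p \<in> {(i, j). i \<in> V \<and> j \<in> V \<and> i < j \<and> E i j \<and> \<kappa> i < \<kappa> j} \<longleftrightarrow> p \<in> ?A \<union> ?B"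
      using assms(2) assms(3)[of i] assms(3)[of j] assms(4)[of i] assms(4)[of j] assms(5)[of i] assms(5)[of j]
      unfolding p by (cases "i \<in> C"; cases "j \<in> C") auto
  qed
  moreover have "finite ?A" "finite ?B"
    using assms(1,2) by (auto intro: finite_subset[of _ "V \<times> V"])
  moreover have "?A \<inter> ?B = {}" by auto
  ultimately show ?thesis
    unfolding asc_def edges_into_def by (simp add: card_Un_disjoint)
qed

text \<open>A colouring amounts to its class C of colour c together with a colouring of the rest. As
  c exceeds all other colours in use, the ascents that meet C depend on C alone: every edge entering
  C from below counts, none leaving C upwards does.\<close>

lemma chrom_qsf_top_color:
  assumes "finite V" "\<forall>c'>c. \<alpha> c' = 0"
  shows "chrom_qsf V E \<alpha> = (\<Sum>C\<in>indep_sets V E (\<alpha> c).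
           [:0, 1:] ^ edges_into V E C * chrom_qsf (V - C) E (\<alpha>(c := 0)))"
proof -
  have fin: "finite (indep_sets V E (\<alpha> c))"
    using assms(1) by (auto simp: indep_sets_def intro: finite_subset[of _ "Pow V"])
  have supp: "{d. (\<alpha>(c := 0)) d \<noteq> 0} \<subseteq> {..<c}"
  proof
    fix d assume "d \<in> {d. (\<alpha>(c := 0)) d \<noteq> 0}"
    then have "d \<noteq> c" "\<alpha> d \<noteq> 0" by (auto split: if_splits)
    then show "d \<in> {..<c}" using assms(2) by (cases "d > c") auto
  qed
  have fin': "finite (colorings (V - C) E (\<alpha>(c := 0)))" for C
    by (intro finite_colorings finite_Diff assms(1) finite_subset[OF supp] finite_lessThan)
  let ?S = "Sigma (indep_sets V E (\<alpha> c)) (\<lambda>C. colorings (V - C) E (\<alpha>(c := 0)))"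
  let ?to = "\<lambda>\<kappa>. ({v \<in> V. \<kappa> v = c}, restrict \<kappa> {v \<in> V. \<kappa> v \<noteq> c})"
  let ?from = "\<lambda>(C, \<kappa>). restrict (\<lambda>v. if v \<in> C then c else \<kappa> v) V"
  have lt: "\<kappa> v < c" if "\<kappa> \<in> colorings (V - C) E (\<alpha>(c := 0))" "v \<in> V - C" for C \<kappa> v
  proof -
    have "\<kappa> v \<in> {d. (\<alpha>(c := 0)) d \<noteq> 0}"
      using coloring_in_support[OF finite_Diff[OF assms(1)] that] by (rule CollectI)
    then show ?thesis using supp by blast
  qed
  have VC: "V - {v \<in> V. \<kappa> v = c} = {v \<in> V. \<kappa> v \<noteq> c}" for \<kappa> :: "nat \<Rightarrow> nat" by auto
  have "chrom_qsf V E \<alpha> = (\<Sum>p\<in>?S. [:0, 1:] ^ (edges_into V E (fst p) + asc (V - fst p) E (snd p)))"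
    unfolding chrom_qsf_colorings
  proof (rule sum.reindex_bij_witness[where i = ?from and j = ?to])
    fix \<kappa> assume k: "\<kappa> \<in> colorings V E \<alpha>"
    show "?from (?to \<kappa>) = \<kappa>"
      using k by (auto simp: colorings_def PiE_iff extensional_def restrict_def fun_eq_iff)
    have "{v \<in> V. \<kappa> v = c} \<in> indep_sets V E (\<alpha> c)"
      using k by (simp add: colorings_def indep_sets_def proper_col_def) metis
    moreover have "card {v \<in> V. \<kappa> v \<noteq> c \<and> restrict \<kappa> {v \<in> V. \<kappa> v \<noteq> c} v = d} = (\<alpha>(c := 0)) d" for d
    proof (cases "d = c")
      case True
      then have "{v \<in> V. \<kappa> v \<noteq> c \<and> restrict \<kappa> {v \<in> V. \<kappa> v \<noteq> c} v = d} = {}" by auto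
      then show ?thesis using True by (metis card.empty fun_upd_same)
    next
      case False
      then have "{v \<in> V. \<kappa> v \<noteq> c \<and> restrict \<kappa> {v \<in> V. \<kappa> v \<noteq> c} v = d} = {v \<in> V. \<kappa> v = d}" by auto
      then show ?thesis using False k by (simp add: colorings_def)
    qed
    moreover have "proper_col {v \<in> V. \<kappa> v \<noteq> c} E (restrict \<kappa> {v \<in> V. \<kappa> v \<noteq> c})"
      using k by (simp add: colorings_def proper_col_def)
    moreover have "restrict \<kappa> {v \<in> V. \<kappa> v \<noteq> c} \<in> {v \<in> V. \<kappa> v \<noteq> c} \<rightarrow>\<^sub>E UNIV"
      by (rule restrict_PiE_iff[THEN iffD2]) simp
    ultimately show "?to \<kappa> \<in> ?S"
      unfolding mem_Sigma_iff colorings_def VC mem_Collect_eq conj_assoc by blast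
    have "asc V E \<kappa> = edges_into V E {v \<in> V. \<kappa> v = c}
        + asc (V - {v \<in> V. \<kappa> v = c}) E (restrict \<kappa> {v \<in> V. \<kappa> v \<noteq> c})"
    proof (rule asc_insert_top[where c = c])
      fix i assume "i \<in> V - {v \<in> V. \<kappa> v = c}"
      then show "\<kappa> i < c"
        using coloring_in_support[OF assms(1) k, of i] assms(2)
        by (metis (mono_tags, lifting) DiffE mem_Collect_eq nat_neq_iff)
    qed (use assms(1) in auto)
    then show "[:0, 1:] ^ (edges_into V E (fst (?to \<kappa>)) + asc (V - fst (?to \<kappa>)) E (snd (?to \<kappa>)))
        = [:0, 1:] ^ asc V E \<kappa>" by simp
  next
    fix p assume p: "p \<in> ?S"
    obtain C \<kappa> where p_eq: "p = (C, \<kappa>)" by force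
    with p have C: "C \<subseteq> V" "card C = \<alpha> c" "\<And>i j. i \<in> C \<Longrightarrow> j \<in> C \<Longrightarrow> \<not> E i j"
      and k: "\<kappa> \<in> colorings (V - C) E (\<alpha>(c := 0))"
      by (auto simp: indep_sets_def)
    note ltc = lt[OF k]
    have from_v: "?from p v = (if v \<in> C then c else \<kappa> v)" if "v \<in> V" for v
      using that by (simp add: p_eq)
    have cls: "{v \<in> V. ?from p v = c} = C"
    proof (rule set_eqI)
      fix v
      show "v \<in> {v \<in> V. ?from p v = c} \<longleftrightarrow> v \<in> C"
        using C(1) ltc[of v] from_v[of v] by (cases "v \<in> C") auto
    qed
    show "?to (?from p) = p"
    proof -
      have "{v \<in> V. ?from p v \<noteq> c} = V - C" using cls by (simp add: set_eq_iff) blast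
      moreover have "restrict (?from p) (V - C) = \<kappa>"
        using k by (auto simp: p_eq colorings_def PiE_iff extensional_def restrict_def fun_eq_iff)
      ultimately show ?thesis using cls p_eq by simp
    qed
    have "card {v \<in> V. ?from p v = d} = \<alpha> d" for d
    proof (cases "d = c")
      case True
      then show ?thesis using cls C by simp
    next
      case False
      then have "{v \<in> V. ?from p v = d} = {v \<in> V - C. \<kappa> v = d}"
        using C(1) from_v by auto
      then show ?thesis using k False by (simp add: colorings_def)
    qed
    moreover have "proper_col V E (?from p)"
      unfolding proper_col_def
    proof (intro ballI impI)
      fix i j assume ij: "i \<in> V" "j \<in> V" "E i j"
      show "?from p i \<noteq> ?from p j"
        using k ij C(3)[of i j] ltc[of i] ltc[of j]
        by (cases "i \<in> C"; cases "j \<in> C") (auto simp: p_eq colorings_def proper_col_def)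
    qed
    ultimately show "?from p \<in> colorings V E \<alpha>"
      unfolding colorings_def by (auto simp: p_eq)
  qed
  also have "\<dots> = (\<Sum>C\<in>indep_sets V E (\<alpha> c). \<Sum>\<kappa>\<in>colorings (V - C) E (\<alpha>(c := 0)).
      [:0, 1:] ^ (edges_into V E C + asc (V - C) E \<kappa>))"
    using fin fin' by (subst sum.Sigma) (auto simp: split_def)
  finally show ?thesis
    unfolding chrom_qsf_colorings by (simp add: power_add sum_distrib_left)
qed


definition down_degree :: "nat set \<Rightarrow> (nat \<Rightarrow> nat \<Rightarrow> bool) \<Rightarrow> nat \<Rightarrow> nat" where
  "down_degree V E v = card {i \<in> V. i < v \<and> E i v}"

lemma chrom_qsf_top_single:
  assumes "finite V" "\<forall>c'>c. \<alpha> c' = 0" "\<alpha> c = 1" "\<And>i. \<not> E i i"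
  shows "chrom_qsf V E \<alpha> = (\<Sum>v\<in>V. [:0, 1:] ^ down_degree V E v * chrom_qsf (V - {v}) E (\<alpha>(c := 0)))"
proof -
  have "indep_sets V E 1 = (\<lambda>v. {v}) ` V"
    using assms(4) by (auto simp: indep_sets_def card_1_singleton_iff image_iff)
  moreover have "edges_into V E {v} = down_degree V E v" for v
  proof -
    have "{(i, j). i \<in> V - {v} \<and> j \<in> {v} \<and> i < j \<and> E i j} = (\<lambda>i. (i, v)) ` {i \<in> V. i < v \<and> E i v}"
      by auto
    then show ?thesis
      unfolding edges_into_def down_degree_def by (simp add: card_image inj_on_def)
  qed
  moreover have "chrom_qsf V E \<alpha> = (\<Sum>C\<in>indep_sets V E (\<alpha> c).
      [:0, 1:] ^ edges_into V E C * chrom_qsf (V - C) E (\<alpha>(c := 0)))"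
    using assms(1,2) by (rule chrom_qsf_top_color)
  ultimately show ?thesis
    by (simp only: assms(3)) (simp add: sum.reindex)
qed

lemma chrom_qsf_top_pair:
  assumes "finite V" "\<forall>c'>c. \<alpha> c' = 0" "\<alpha> c = 2" "\<And>i. \<not> E i i" "\<And>i j. E i j \<longleftrightarrow> E j i"
  shows "chrom_qsf V E \<alpha> = (\<Sum>(u, v)\<in>{(u, v). u \<in> V \<and> v \<in> V \<and> u < v \<and> \<not> E u v}.
           [:0, 1:] ^ (down_degree V E u + down_degree V E v) * chrom_qsf (V - {u, v}) E (\<alpha>(c := 0)))"
proof -
  let ?P = "{(u, v). u \<in> V \<and> v \<in> V \<and> u < v \<and> \<not> E u v}"
  have img: "indep_sets V E 2 = (\<lambda>(u, v). {u, v}) ` ?P"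
  proof
    show "indep_sets V E 2 \<subseteq> (\<lambda>(u, v). {u, v}) ` ?P"
    proof
      fix C assume C: "C \<in> indep_sets V E 2"
      then obtain u v where uv: "C = {u, v}" "u \<noteq> v"
        by (auto simp: indep_sets_def card_2_iff)
      show "C \<in> (\<lambda>(u, v). {u, v}) ` ?P"
      proof (cases "u < v")
        case True
        then show ?thesis using C uv by (intro image_eqI[of _ _ "(u, v)"]) (auto simp: indep_sets_def)
      next
        case False
        then show ?thesis using C uv by (intro image_eqI[of _ _ "(v, u)"]) (auto simp: indep_sets_def)
      qed
    qed
    show "(\<lambda>(u, v). {u, v}) ` ?P \<subseteq> indep_sets V E 2"
      using assms(4,5) by (auto simp: indep_sets_def)
  qed
  have inj: "inj_on (\<lambda>(u, v). {u, v}) ?P"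
    by (auto simp: inj_on_def doubleton_eq_iff)
  \<comment> \<open>No edge joins u and v, so the down-degrees taken in all of V lose nothing when
    the pair is removed.\<close>
  have "edges_into V E {u, v} = down_degree V E u + down_degree V E v" if "u < v" "\<not> E u v" for u v
  proof -
    have "{(i, j). i \<in> V - {u, v} \<and> j \<in> {u, v} \<and> i < j \<and> E i j}
        = (\<lambda>i. (i, u)) ` {i \<in> V. i < u \<and> E i u} \<union> (\<lambda>i. (i, v)) ` {i \<in> V. i < v \<and> E i v}"
      using that by auto
    moreover have "(\<lambda>i. (i, u)) ` {i \<in> V. i < u \<and> E i u} \<inter> (\<lambda>i. (i, v)) ` {i \<in> V. i < v \<and> E i v} = {}"
      using that by auto
    ultimately show ?thesis
      unfolding edges_into_def down_degree_def using assms(1) by (simp add: card_Un_disjoint card_image inj_on_def)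
  qed
  note into = this
  have "chrom_qsf V E \<alpha> = (\<Sum>C\<in>indep_sets V E (\<alpha> c).
      [:0, 1:] ^ edges_into V E C * chrom_qsf (V - C) E (\<alpha>(c := 0)))"
    using assms(1,2) by (rule chrom_qsf_top_color)
  also have "\<dots> = (\<Sum>p\<in>?P. case p of (u, v) \<Rightarrow> [:0, 1:] ^ edges_into V E {u, v} * chrom_qsf (V - {u, v}) E (\<alpha>(c := 0)))"
    unfolding assms(3) img by (subst sum.reindex[OF inj]) (simp add: split_def)
  also have "\<dots> = (\<Sum>(u, v)\<in>?P. [:0, 1:] ^ (down_degree V E u + down_degree V E v) * chrom_qsf (V - {u, v}) E (\<alpha>(c := 0)))"
    by (rule sum.cong) (auto simp: into)
  finally show ?thesis .
qed

section \<open>Monomials with exponents at most two\<close>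

definition col_content :: "(nat \<Rightarrow> nat) \<Rightarrow> nat \<Rightarrow> nat \<Rightarrow> bool" where
  "col_content \<alpha> e d \<longleftrightarrow> finite {c. \<alpha> c \<noteq> 0} \<and> (\<forall>c. \<alpha> c \<le> 2) \<and> card {c. \<alpha> c = 1} = e \<and> card {c. \<alpha> c = 2} = d"

lemma col_content_finite:
  assumes "col_content \<alpha> e d"
  shows "finite {c. \<alpha> c = 1}" "finite {c. \<alpha> c = 2}"
proof -
  have "{c. \<alpha> c = 1} \<subseteq> {c. \<alpha> c \<noteq> 0}" "{c. \<alpha> c = 2} \<subseteq> {c. \<alpha> c \<noteq> 0}" by auto
  then show "finite {c. \<alpha> c = 1}" "finite {c. \<alpha> c = 2}"
    using assms finite_subset by (simp_all add: col_content_def) blast+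
qed

lemma col_content_zero:
  assumes "col_content \<alpha> 0 0"
  shows "\<alpha> = (\<lambda>_. 0)"
proof
  fix c
  have "{c. \<alpha> c = 1} = {}" "{c. \<alpha> c = 2} = {}"
    using assms col_content_finite[OF assms] by (auto simp: col_content_def)
  then have "\<alpha> c \<noteq> 1" "\<alpha> c \<noteq> 2" by auto
  moreover have "\<alpha> c \<le> 2" using assms by (simp add: col_content_def)
  ultimately show "\<alpha> c = 0" by linarith
qed

lemma col_content_top:
  assumes "col_content \<alpha> e d" "0 < e + 2 * d"
  obtains c where "\<forall>c'>c. \<alpha> c' = 0" "\<alpha> c = 1" "0 < e" "col_content (\<alpha>(c := 0)) (e - 1) d"
  | c where "\<forall>c'>c. \<alpha> c' = 0" "\<alpha> c = 2" "0 < d" "col_content (\<alpha>(c := 0)) e (d - 1)"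
proof -
  let ?S = "{c. \<alpha> c \<noteq> 0}"
  define c where "c = Max ?S"
  have fin: "finite ?S" using assms by (simp add: col_content_def)
  have "?S \<noteq> {}"
  proof
    assume "?S = {}"
    then have "{c. \<alpha> c = 1} = {}" "{c. \<alpha> c = 2} = {}" by auto
    then show False using assms by (simp add: col_content_def)
  qed
  then have c: "\<alpha> c \<noteq> 0" using Max_in[OF fin] by (auto simp: c_def)
  have top: "\<alpha> c' = 0" if "c' > c" for c'
    using Max_ge[OF fin, of c'] that by (auto simp: c_def)
  note f = col_content_finite[OF assms(1)]
  have le: "\<forall>c. \<alpha> c \<le> 2" using assms by (simp add: col_content_def)
  then have "\<alpha> c = 1 \<or> \<alpha> c = 2" using c by (metis One_nat_def le_Suc_eq le_zero_eq numeral_2_eq_2)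
  then show thesis
  proof
    assume c1: "\<alpha> c = 1"
    have "{d. (\<alpha>(c := 0)) d = 1} = {d. \<alpha> d = 1} - {c}" "{d. (\<alpha>(c := 0)) d = 2} = {d. \<alpha> d = 2}"
      "{d. (\<alpha>(c := 0)) d \<noteq> 0} \<subseteq> ?S"
      using c1 by auto
    then have "col_content (\<alpha>(c := 0)) (e - 1) d"
      using assms(1) c1 f le finite_subset[OF _ fin] unfolding col_content_def by simp
    moreover have "0 < e" using assms(1) c1 f by (auto simp: col_content_def card_gt_0_iff)
    ultimately show thesis using that(1) top c1 by blast
  next
    assume c2: "\<alpha> c = 2"
    have "{d. (\<alpha>(c := 0)) d = 2} = {d. \<alpha> d = 2} - {c}" "{d. (\<alpha>(c := 0)) d = 1} = {d. \<alpha> d = 1}"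
      "{d. (\<alpha>(c := 0)) d \<noteq> 0} \<subseteq> ?S"
      using c2 by auto
    then have "col_content (\<alpha>(c := 0)) e (d - 1)"
      using assms(1) c2 f le finite_subset[OF _ fin] unfolding col_content_def by simp
    moreover have "0 < d" using assms(1) c2 f by (auto simp: col_content_def card_gt_0_iff)
    ultimately show thesis using that(2) top c2 by blast
  qed
qed

section \<open>Weights of vertices in a clique and in its blocks\<close>

text \<open>In a clique the down-degree of a vertex is its rank, so this is the total weight of
  choosing the vertex that receives the largest colour.\<close>

lemma sum_rank:
  assumes "finite (W :: nat set)"
  shows "(\<Sum>v\<in>W. [:0, 1:] ^ card {i \<in> W. i < v}) = qint (card W)"
  using assms
proof (induction rule: finite_linorder_max_induct)
  case (insert x W)
  have "{i \<in> insert x W. i < v} = {i \<in> W. i < v}" if "v \<in> W" for v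
    using insert that by force
  moreover have "{i \<in> insert x W. i < x} = W" using insert by auto
  moreover have "x \<notin> W" using insert by auto
  ultimately show ?case
    using insert by (simp add: qint_def)
qed (simp add: qint_def)

text \<open>Half-open intervals, so that the cuts 0, s, r, n split a set of inner vertices into the
  three blocks and adjacent blocks merge without overlap.\<close>

definition block :: "nat set \<Rightarrow> nat \<Rightarrow> nat \<Rightarrow> nat set" where
  "block W p q = {v \<in> W. p < v \<and> v \<le> q}"

lemma sum_rank_block:
  assumes "finite W"
  shows "(\<Sum>v\<in>block W p q. [:0, 1:] ^ card {i \<in> W. i < v}) = [:0, 1:] ^ card {i \<in> W. i \<le> p} * qint (card (block W p q))"
proof -
  have "card {i \<in> W. i < v} = card {i \<in> W. i \<le> p} + card {i \<in> block W p q. i < v}" if "v \<in> block W p q" for v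
  proof -
    have "{i \<in> W. i < v} = {i \<in> W. i \<le> p} \<union> {i \<in> block W p q. i < v}"
      using that by (auto simp: block_def)
    moreover have "{i \<in> W. i \<le> p} \<inter> {i \<in> block W p q. i < v} = {}"
      by (auto simp: block_def)
    ultimately show ?thesis using assms by (simp add: card_Un_disjoint block_def)
  qed
  then have "(\<Sum>v\<in>block W p q. [:0, 1 :: rat:] ^ card {i \<in> W. i < v})
      = [:0, 1:] ^ card {i \<in> W. i \<le> p} * (\<Sum>v\<in>block W p q. [:0, 1:] ^ card {i \<in> block W p q. i < v})"
    by (simp add: power_add sum_distrib_left)
  moreover have "finite (block W p q)" using assms by (simp add: block_def)
  ultimately show ?thesis by (simp only: sum_rank)
qed

lemma card_block_remove:
  assumes "finite W" "v \<in> W"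
  shows "card (block (W - {v}) p q) = (if p < v \<and> v \<le> q then card (block W p q) - 1 else card (block W p q))"
proof -
  have "block (W - {v}) p q = block W p q - {v}" by (auto simp: block_def)
  moreover have "v \<in> block W p q \<longleftrightarrow> p < v \<and> v \<le> q" using assms by (simp add: block_def)
  moreover have "finite (block W p q)" using assms by (simp add: block_def)
  ultimately show ?thesis by simp
qed

lemma card_block_add:
  assumes "finite W" "p \<le> q" "q \<le> r"
  shows "card (block W p r) = card (block W p q) + card (block W q r)"
proof -
  have "block W p r = block W p q \<union> block W q r" "block W p q \<inter> block W q r = {}"
    using assms by (auto simp: block_def)
  then show ?thesis using assms by (simp add: card_Un_disjoint block_def)
qed

lemma sum_block_add:
  assumes "finite W" "p \<le> q" "q \<le> r"
  shows "sum f (block W p r) = sum f (block W p q) + sum f (block W q r)"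
proof -
  have "block W p r = block W p q \<union> block W q r" "block W p q \<inter> block W q r = {}"
    using assms by (auto simp: block_def)
  then show ?thesis using assms by (simp add: sum.union_disjoint block_def)
qed

subsection \<open>Products of two elementary symmetric functions\<close>

text \<open>The indicators are read in \<open>nat\<close>, so that one set counts the coefficients
  over every semiring; \<open>e_unimodal_combination\<close> compares those over \<open>rat\<close>
  and \<open>rat poly\<close>.\<close>

definition esplit :: "nat \<Rightarrow> nat \<Rightarrow> (nat \<Rightarrow> nat) \<Rightarrow> (nat \<Rightarrow> nat) set" where
  "esplit k l \<alpha> = {\<beta>. (\<forall>i. \<beta> i \<le> \<alpha> i) \<and> elem k \<beta> = (1 :: nat) \<and> elem l (\<lambda>i. \<alpha> i - \<beta> i) = (1 :: nat)}"

lemma elem_nat: "elem k \<beta> = of_nat (elem k \<beta>)"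
  by (simp add: elem_def)

lemma elem_eq_1:
  "elem k \<beta> = (1 :: nat) \<longleftrightarrow> (\<forall>i. \<beta> i \<le> 1) \<and> finite {i. \<beta> i \<noteq> 0} \<and> card {i. \<beta> i = 1} = k"
  by (simp add: elem_def)

lemma esplitD:
  assumes "\<beta> \<in> esplit k l \<alpha>"
  shows "\<And>i. \<beta> i \<le> \<alpha> i" "\<And>i. \<beta> i \<le> 1" "finite {i. \<beta> i \<noteq> 0}" "card {i. \<beta> i = 1} = k"
    "\<And>i. \<alpha> i - \<beta> i \<le> 1" "finite {i. \<alpha> i - \<beta> i \<noteq> 0}" "card {i. \<alpha> i - \<beta> i = 1} = l"
  using assms unfolding esplit_def mem_Collect_eq elem_eq_1 by blast+

lemma elem_0_or_1: "elem k \<beta> = (0 :: nat) \<or> elem k \<beta> = (1 :: nat)"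
  by (simp add: elem_def)

lemma finite_below:
  assumes "finite {i. \<alpha> i \<noteq> (0 :: nat)}"
  shows "finite {\<beta>. \<forall>i. \<beta> i \<le> \<alpha> i}"
proof (rule finite_subset)
  let ?S = "{i. \<alpha> i \<noteq> 0}"
  show "{\<beta>. \<forall>i. \<beta> i \<le> \<alpha> i} \<subseteq> {\<beta>. \<forall>i. (i \<in> ?S \<longrightarrow> \<beta> i \<in> {..Max (\<alpha> ` ?S)}) \<and> (i \<notin> ?S \<longrightarrow> \<beta> i = 0)}"
  proof (intro subsetI CollectI conjI allI impI)
    fix \<beta> i assume b: "\<beta> \<in> {\<beta>. \<forall>i. \<beta> i \<le> \<alpha> i}"
    show "\<beta> i \<in> {..Max (\<alpha> ` ?S)}" if "i \<in> ?S"
    proof -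
      have "\<beta> i \<le> \<alpha> i" using b by simp
      also have "\<alpha> i \<le> Max (\<alpha> ` ?S)" using that assms by (intro Max_ge) auto
      finally show ?thesis by simp
    qed
    show "\<beta> i = 0" if "i \<notin> ?S"
    proof -
      have "\<beta> i \<le> \<alpha> i" using b by simp
      then show ?thesis using that by simp
    qed
  qed
  show "finite {\<beta>. \<forall>i. (i \<in> ?S \<longrightarrow> \<beta> i \<in> {..Max (\<alpha> ` ?S)}) \<and> (i \<notin> ?S \<longrightarrow> \<beta> i = 0)}"
    by (rule finite_set_of_finite_funs[OF assms finite_atMost])
qed

lemma ser_mult_elem_one: "ser_mult (elem l) ser_one \<gamma> = (elem l \<gamma> :: 'a :: comm_semiring_1)"
proof -
  have z: "elem l \<beta> * ser_one (\<lambda>i. \<gamma> i - \<beta> i) = (if \<beta> = \<gamma> then elem l \<gamma> else (0 :: 'a))" if "\<forall>i. \<beta> i \<le> \<gamma> i" for \<beta>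
  proof -
    have "(\<lambda>i. \<gamma> i - \<beta> i) = (\<lambda>_. 0) \<longleftrightarrow> \<beta> = \<gamma>"
      unfolding fun_eq_iff using that by (auto intro: le_antisym)
    then show ?thesis by (simp add: ser_one_def)
  qed
  have "ser_mult (elem l) ser_one \<gamma> = (\<Sum>\<beta>\<in>{\<beta>. \<forall>i. \<beta> i \<le> \<gamma> i}. if \<beta> = \<gamma> then elem l \<gamma> else (0 :: 'a))"
    unfolding ser_mult_def using z by (intro sum.cong) auto
  also have "\<dots> = elem l \<gamma>"
  proof (cases "finite {i. \<gamma> i \<noteq> 0}")
    case True
    then show ?thesis using finite_below[OF True] by simp
  next
    case False
    then have "elem l \<gamma> = (0 :: 'a)" by (simp add: elem_def)
    then show ?thesis by (simp only: if_cancel sum.neutral_const)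
  qed
  finally show ?thesis .
qed

lemma elem_part_single: "elem_part [k] \<alpha> = elem k \<alpha>"
  by (simp add: elem_part_def ser_mult_elem_one)

lemma elem_part_pair: "elem_part [k, l] \<alpha> = (of_nat (card (esplit k l \<alpha>)) :: 'a :: comm_semiring_1)"
proof -
  have "ser_mult (elem l) ser_one = (elem l :: 'a series)"
    by (intro ext ser_mult_elem_one)
  then have "elem_part [k, l] \<alpha> = (\<Sum>\<beta>\<in>{\<beta>. \<forall>i. \<beta> i \<le> \<alpha> i}. elem k \<beta> * elem l (\<lambda>i. \<alpha> i - \<beta> i) :: 'a)"
    by (simp add: elem_part_def ser_mult_def)
  also have "\<dots> = (\<Sum>\<beta>\<in>{\<beta>. \<forall>i. \<beta> i \<le> \<alpha> i}. if \<beta> \<in> esplit k l \<alpha> then 1 else 0)"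
  proof (rule sum.cong)
    fix \<beta> assume "\<beta> \<in> {\<beta>. \<forall>i. \<beta> i \<le> \<alpha> i}"
    then have "\<beta> \<in> esplit k l \<alpha> \<longleftrightarrow> elem k \<beta> = (1 :: nat) \<and> elem l (\<lambda>i. \<alpha> i - \<beta> i) = (1 :: nat)"
      by (simp add: esplit_def)
    then show "elem k \<beta> * elem l (\<lambda>i. \<alpha> i - \<beta> i) = (if \<beta> \<in> esplit k l \<alpha> then 1 else (0 :: 'a))"
      using elem_nat[of k \<beta>, where 'a = 'a] elem_nat[of l "\<lambda>i. \<alpha> i - \<beta> i", where 'a = 'a]
        elem_0_or_1[of k \<beta>] elem_0_or_1[of l "\<lambda>i. \<alpha> i - \<beta> i"] by auto
  qed simp
  also have "\<dots> = of_nat (card (esplit k l \<alpha>))"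
  proof (cases "finite {i. \<alpha> i \<noteq> 0}")
    case True
    have sub: "esplit k l \<alpha> \<subseteq> {\<beta>. \<forall>i. \<beta> i \<le> \<alpha> i}" by (auto simp: esplit_def)
    then have "{\<beta>. \<forall>i. \<beta> i \<le> \<alpha> i} \<inter> esplit k l \<alpha> = esplit k l \<alpha>" by blast
    then show ?thesis
      using sum.inter_restrict[OF finite_below[OF True], of "\<lambda>_. 1 :: 'a" "esplit k l \<alpha>"] by simp
  next
    case False
    have "esplit k l \<alpha> = {}"
    proof (rule ccontr)
      assume "esplit k l \<alpha> \<noteq> {}"
      then obtain \<beta> where b: "\<beta> \<in> esplit k l \<alpha>" by blast
      note esplitD(3,6)[OF b]
      moreover have "{i. \<alpha> i \<noteq> 0} \<subseteq> {i. \<beta> i \<noteq> 0} \<union> {i. \<alpha> i - \<beta> i \<noteq> 0}" by auto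
      ultimately show False using False finite_subset by blast
    qed
    then show ?thesis by simp
  qed
  finally show ?thesis .
qed

lemma sum_col_content:
  assumes "col_content \<alpha> e d"
  shows "(\<Sum>c | \<alpha> c \<noteq> 0. \<alpha> c) = e + 2 * d"
proof -
  have "{c. \<alpha> c \<noteq> 0} = {c. \<alpha> c = 1} \<union> {c. \<alpha> c = 2}"
  proof (rule set_eqI)
    fix c
    have "\<alpha> c \<le> 2" using assms by (simp add: col_content_def)
    then show "c \<in> {c. \<alpha> c \<noteq> 0} \<longleftrightarrow> c \<in> {c. \<alpha> c = 1} \<union> {c. \<alpha> c = 2}" by auto
  qed
  moreover have "{c. \<alpha> c = 1} \<inter> {c. \<alpha> c = 2} = {}" by auto
  ultimately have "(\<Sum>c | \<alpha> c \<noteq> 0. \<alpha> c) = (\<Sum>c | \<alpha> c = 1. \<alpha> c) + (\<Sum>c | \<alpha> c = 2. \<alpha> c)"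
    using col_content_finite[OF assms] by (simp add: sum.union_disjoint)
  also have "\<dots> = (\<Sum>c | \<alpha> c = 1. 1) + (\<Sum>c | \<alpha> c = 2. 2)"
    by (intro arg_cong2[where f = "(+)"] sum.cong) auto
  finally show ?thesis using assms by (simp add: col_content_def)
qed

lemma elem_col_content:
  "elem k \<alpha> = (if col_content \<alpha> k 0 then 1 else 0)"
proof -
  have "(\<forall>i. \<alpha> i \<le> 1) \<and> finite {i. \<alpha> i \<noteq> 0} \<and> card {i. \<alpha> i = 1} = k \<longleftrightarrow> col_content \<alpha> k 0"
  proof
    assume "(\<forall>i. \<alpha> i \<le> 1) \<and> finite {i. \<alpha> i \<noteq> 0} \<and> card {i. \<alpha> i = 1} = k"
    moreover from this have "{i. \<alpha> i = 2} = {}" "\<forall>i. \<alpha> i \<le> 2"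
      by (auto simp: set_eq_iff) (metis not_less_eq_eq numeral_2_eq_2 order_refl One_nat_def, metis le_SucI numeral_2_eq_2 One_nat_def)
    ultimately show "col_content \<alpha> k 0" by (simp add: col_content_def)
  next
    assume c: "col_content \<alpha> k 0"
    then have "{i. \<alpha> i = 2} = {}" using col_content_finite[OF c] by (simp add: col_content_def)
    then have "\<alpha> i \<noteq> 2" for i by auto
    moreover have "\<alpha> i \<le> 2" for i using c by (simp add: col_content_def)
    ultimately have "\<alpha> i \<le> 1" for i by (metis One_nat_def Suc_1 le_Suc_eq)
    then show "(\<forall>i. \<alpha> i \<le> 1) \<and> finite {i. \<alpha> i \<noteq> 0} \<and> card {i. \<alpha> i = 1} = k"
      using c by (simp add: col_content_def)
  qed
  then show ?thesis unfolding elem_def by simp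
qed

text \<open>Disposes of all monomials of another shape: e_k e_l vanishes there, and for k + l = n so
  does the chromatic function, by \<open>chrom_nonzero_col_content\<close>.\<close>

lemma esplit_col_content:
  assumes "\<beta> \<in> esplit k l \<alpha>"
  shows "\<exists>e d. col_content \<alpha> e d \<and> e + 2 * d = k + l"
proof -
  let ?g = "\<lambda>i. \<alpha> i - \<beta> i"
  note b = esplitD[OF assms]
  have cb: "col_content \<beta> k 0"
  proof -
    have "elem k \<beta> = (1 :: nat)" unfolding elem_eq_1 using b(2-4) by blast
    then show ?thesis by (simp add: elem_col_content split: if_splits)
  qed
  have cg: "col_content ?g l 0"
  proof -
    have "elem l ?g = (1 :: nat)" unfolding elem_eq_1 using b(5-7) by blast
    then show ?thesis by (simp add: elem_col_content split: if_splits)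
  qed
  note fin = b(3,6)
  have un: "{i. \<alpha> i \<noteq> 0} = {i. \<beta> i \<noteq> 0} \<union> {i. ?g i \<noteq> 0}"
  proof (rule set_eqI)
    fix i
    show "i \<in> {i. \<alpha> i \<noteq> 0} \<longleftrightarrow> i \<in> {i. \<beta> i \<noteq> 0} \<union> {i. ?g i \<noteq> 0}"
      using b(1)[of i] by auto
  qed
  have "\<alpha> i \<le> 2" for i using b(2)[of i] b(5)[of i] by linarith
  then have c: "col_content \<alpha> (card {c. \<alpha> c = 1}) (card {c. \<alpha> c = 2})"
    using fin un by (simp add: col_content_def)
  have finU: "finite {i. \<alpha> i \<noteq> 0}" using un fin by simp
  have "(\<Sum>c | \<alpha> c \<noteq> 0. \<alpha> c) = (\<Sum>c | \<alpha> c \<noteq> 0. \<beta> c + ?g c)"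
    using b(1) by simp
  also have "\<dots> = (\<Sum>c | \<alpha> c \<noteq> 0. \<beta> c) + (\<Sum>c | \<alpha> c \<noteq> 0. ?g c)" by (rule sum.distrib)
  also have "(\<Sum>c | \<alpha> c \<noteq> 0. \<beta> c) = (\<Sum>c | \<beta> c \<noteq> 0. \<beta> c)"
    using finU un by (intro sum.mono_neutral_right) auto
  also have "(\<Sum>c | \<alpha> c \<noteq> 0. ?g c) = (\<Sum>c | ?g c \<noteq> 0. ?g c)"
    using finU un by (intro sum.mono_neutral_right) auto
  finally have "(\<Sum>c | \<alpha> c \<noteq> 0. \<alpha> c) = k + l"
    using sum_col_content[OF cb] sum_col_content[OF cg] by simp
  then show ?thesis using c sum_col_content[OF c] by auto
qed

text \<open>Both factors are squarefree, so each squared variable goes once into each of them; of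
  the e simple variables, l - d remain to be chosen for the second factor.\<close>

lemma card_esplit:
  assumes "col_content \<alpha> e d" "e + 2 * d = k + l"
  shows "card (esplit k l \<alpha>) = (if d \<le> l then e choose (l - d) else 0)"
proof -
  let ?O = "{c. \<alpha> c = 1}" and ?T = "{c. \<alpha> c = 2}"
  have fin: "finite ?O" "finite ?T" using col_content_finite[OF assms(1)] .
  have le2: "\<alpha> i \<le> 2" for i using assms(1) by (simp add: col_content_def)
  have card: "card ?O = e" "card ?T = d" using assms(1) by (auto simp: col_content_def)
  have finS: "finite {c. \<alpha> c \<noteq> 0}" using assms(1) by (simp add: col_content_def)
  let ?B = "\<lambda>\<beta>. {c. \<alpha> c = 1 \<and> \<beta> c = (0 :: nat)}"
  have shape: "\<alpha> i = 0 \<Longrightarrow> \<beta> i = 0" "\<alpha> i = 2 \<Longrightarrow> \<beta> i = 1" "\<alpha> i = 1 \<Longrightarrow> \<beta> i \<le> 1"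
    if "\<beta> \<in> esplit k l \<alpha>" for \<beta> i
  proof -
    have "\<beta> i \<le> \<alpha> i" "\<beta> i \<le> 1" "\<alpha> i - \<beta> i \<le> 1"
      using esplitD[OF that] by blast+
    then show "\<alpha> i = 0 \<Longrightarrow> \<beta> i = 0" "\<alpha> i = 2 \<Longrightarrow> \<beta> i = 1" "\<alpha> i = 1 \<Longrightarrow> \<beta> i \<le> 1" by auto
  qed
  have size: "l = d + card (?B \<beta>)" if b: "\<beta> \<in> esplit k l \<alpha>" for \<beta>
  proof -
    have "{i. \<alpha> i - \<beta> i = 1} = ?T \<union> ?B \<beta>"
    proof (rule set_eqI)
      fix i
      show "i \<in> {i. \<alpha> i - \<beta> i = 1} \<longleftrightarrow> i \<in> ?T \<union> ?B \<beta>"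
        using shape[OF b, of i] le2[of i] by (cases "\<alpha> i = 0"; cases "\<alpha> i = 2") auto
    qed
    moreover have "card {i. \<alpha> i - \<beta> i = 1} = l"
      by (rule esplitD(7)[OF b])
    moreover have "?T \<inter> ?B \<beta> = {}" by auto
    ultimately show ?thesis using fin card by (simp add: card_Un_disjoint)
  qed
  show ?thesis
  proof (cases "d \<le> l")
    case False
    have "esplit k l \<alpha> = {}"
    proof (rule ccontr)
      assume "esplit k l \<alpha> \<noteq> {}"
      then obtain \<beta> where "\<beta> \<in> esplit k l \<alpha>" by blast
      from size[OF this] False show False by simp
    qed
    then show ?thesis using False by simp
  next
    case True
    let ?mk = "\<lambda>B i. if \<alpha> i = 2 then 1 else if \<alpha> i = 1 \<and> i \<notin> B then 1 else (0 :: nat)"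
    have "bij_betw ?B (esplit k l \<alpha>) {B. B \<subseteq> ?O \<and> card B = l - d}"
    proof (rule bij_betw_byWitness[where f' = ?mk])
      show "\<forall>\<beta>\<in>esplit k l \<alpha>. ?mk (?B \<beta>) = \<beta>"
      proof (intro ballI ext)
        fix \<beta> i assume b: "\<beta> \<in> esplit k l \<alpha>"
        show "?mk (?B \<beta>) i = \<beta> i"
          using shape[OF b, of i] le2[of i] by (cases "\<alpha> i = 0"; cases "\<alpha> i = 2") auto
      qed
      show "\<forall>B\<in>{B. B \<subseteq> ?O \<and> card B = l - d}. ?B (?mk B) = B"
        by auto
      show "?B ` esplit k l \<alpha> \<subseteq> {B. B \<subseteq> ?O \<and> card B = l - d}"
      proof (intro image_subsetI CollectI conjI)
        fix \<beta> assume "\<beta> \<in> esplit k l \<alpha>"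
        then show "card (?B \<beta>) = l - d" using size[of \<beta>] by linarith
      qed blast
      show "?mk ` {B. B \<subseteq> ?O \<and> card B = l - d} \<subseteq> esplit k l \<alpha>"
      proof (intro image_subsetI)
        fix B assume B: "B \<in> {B. B \<subseteq> ?O \<and> card B = l - d}"
        then have finB: "finite B" using fin finite_subset by blast
        have Bl: "card B \<le> e" using B fin card by (metis (no_types, lifting) card_mono mem_Collect_eq)
        have "{i. ?mk B i = 1} = ?T \<union> (?O - B)" by auto
        moreover have "?T \<inter> (?O - B) = {}" by auto
        moreover have "card (?O - B) = e - card B" using B finB card by (simp add: card_Diff_subset)
        ultimately have 1: "card {i. ?mk B i = 1} = k"
          using fin card B True assms(2) Bl by (simp add: card_Un_disjoint)
        have "{i. \<alpha> i - ?mk B i = 1} = ?T \<union> B"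
        proof (rule set_eqI)
          fix i
          show "i \<in> {i. \<alpha> i - ?mk B i = 1} \<longleftrightarrow> i \<in> ?T \<union> B"
            using B le2[of i] by (cases "\<alpha> i = 0"; cases "\<alpha> i = 2") auto
        qed
        moreover have "?T \<inter> B = {}" using B by auto
        ultimately have 2: "card {i. \<alpha> i - ?mk B i = 1} = l"
          using fin finB card B True by (simp add: card_Un_disjoint)
        have 3: "finite {i. ?mk B i \<noteq> 0}" "finite {i. \<alpha> i - ?mk B i \<noteq> 0}"
          by (rule finite_subset[OF _ finS]; auto)+
        have 4: "\<forall>i. ?mk B i \<le> 1" "\<forall>i. ?mk B i \<le> \<alpha> i" by auto
        have 5: "\<alpha> i - ?mk B i \<le> 1" for i
          using le2[of i] by auto
        show "?mk B \<in> esplit k l \<alpha>"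
          unfolding esplit_def mem_Collect_eq elem_eq_1 using 1 2 3 4 5 by blast
      qed
    qed
    then have "card (esplit k l \<alpha>) = card {B. B \<subseteq> ?O \<and> card B = l - d}"
      by (rule bij_betw_same_card)
    then show ?thesis using True n_subsets[OF fin(1)] card by simp
  qed
qed

subsection \<open>A clique with two partially attached ends\<close>

lemma chrom_qsf_empty: "chrom_qsf {} E (\<lambda>_. 0) = 1"
proof -
  have "colorings {} E (\<lambda>_. 0) = {\<lambda>_. undefined}"
    by (auto simp: colorings_def proper_col_def)
  then show ?thesis by (simp add: chrom_qsf_colorings asc_def)
qed

text \<open>The bounds admit s = 1 and r = n - 1, for which the first or the last block is
  empty.\<close>

locale clique_with_ends =
  fixes E :: "nat \<Rightarrow> nat \<Rightarrow> bool" and s r n :: nat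
  assumes sym: "\<And>i j. E i j \<longleftrightarrow> E j i" and irrefl: "\<And>i. \<not> E i i"
    and edge: "\<And>i j. 1 \<le> i \<Longrightarrow> i < j \<Longrightarrow> j \<le> n \<Longrightarrow> E i j \<longleftrightarrow> \<not> (i = 1 \<and> r < j) \<and> \<not> (j = n \<and> i \<le> s)"
    and sr: "1 \<le> s" "s \<le> r" "r < n"
begin

lemma card_blocks:
  assumes "W \<subseteq> {2..<n}"
  shows "card W = card (block W 0 s) + card (block W s r) + card (block W r n)"
    and "card {i \<in> W. i \<le> 0} = 0"
    and "card {i \<in> W. i \<le> s} = card (block W 0 s)"
    and "card {i \<in> W. i \<le> r} = card (block W 0 s) + card (block W s r)"
    and "card (block W s n) = card (block W s r) + card (block W r n)"
proof -
  have fin: "finite W" using assms finite_subset by blast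
  have "block W 0 n = W" "{i \<in> W. i \<le> 0} = {}" "{i \<in> W. i \<le> s} = block W 0 s" "{i \<in> W. i \<le> r} = block W 0 r"
    using assms by (force simp: block_def)+
  then show "card W = card (block W 0 s) + card (block W s r) + card (block W r n)"
    "card {i \<in> W. i \<le> 0} = 0"
    "card {i \<in> W. i \<le> s} = card (block W 0 s)"
    "card {i \<in> W. i \<le> r} = card (block W 0 s) + card (block W s r)"
    "card (block W s n) = card (block W s r) + card (block W r n)"
    using card_block_add[OF fin, of 0 r n] card_block_add[OF fin, of 0 s r] card_block_add[OF fin, of s r n] sr
    by simp_all
qed

lemma sum_blocks:
  assumes "W \<subseteq> {2..<n}"
  shows "sum f W = sum f (block W 0 s) + sum f (block W s r) + sum f (block W r n)"
    and "sum f (block W s n) = sum f (block W s r) + sum f (block W r n)"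
    and "sum f W = sum f (block W 0 s) + sum f (block W s n)"
    and "sum f W = sum f (block W 0 r) + sum f (block W r n)"
proof -
  have fin: "finite W" using assms finite_subset by blast
  have "block W 0 n = W"
    using assms by (force simp: block_def)
  then show "sum f W = sum f (block W 0 s) + sum f (block W s r) + sum f (block W r n)"
    "sum f (block W s n) = sum f (block W s r) + sum f (block W r n)"
    "sum f W = sum f (block W 0 s) + sum f (block W s n)"
    "sum f W = sum f (block W 0 r) + sum f (block W r n)"
    using sum_block_add[OF fin, of 0 r n f] sum_block_add[OF fin, of 0 s r f] sum_block_add[OF fin, of s r n f] sr
    by (simp_all add: add.assoc)
qed

text \<open>In the applications j is 1 if vertex 1 is present and adjacent to the block, else 0. The
  factor F is constant on a block, because the coefficient of the remaining graph depends only on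
  the block that loses a vertex.\<close>

lemma sum_block_rank:
  assumes "W \<subseteq> {2..<n}" "\<And>v. v \<in> block W p q \<Longrightarrow> down_degree V E v = j + card {i \<in> W. i < v}"
    "\<And>v. v \<in> block W p q \<Longrightarrow> F v = x"
  shows "(\<Sum>v\<in>block W p q. [:0, 1:] ^ down_degree V E v * F v)
    = [:0, 1:] ^ (j + card {i \<in> W. i \<le> p}) * (qint (card (block W p q)) * x)"
proof -
  have fin: "finite W" using assms finite_subset by blast
  have "(\<Sum>v\<in>block W p q. [:0, 1:] ^ down_degree V E v * F v)
      = (\<Sum>v\<in>block W p q. ([:0, 1:] ^ j * x) * [:0, 1:] ^ card {i \<in> W. i < v})"
    using assms(2,3) by (intro sum.cong) (simp_all add: power_add mult_ac)
  then show ?thesis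
    unfolding sum_distrib_left[symmetric] sum_rank_block[OF fin] by (simp only: power_add mult_ac)
qed

lemma down_degree_inner:
  assumes "W \<subseteq> {2..<n}" "v \<in> W"
  shows "down_degree W E v = card {i \<in> W. i < v}"
    and "down_degree (insert n W) E v = card {i \<in> W. i < v}"
    and "down_degree (insert 1 W) E v = (if v \<le> r then 1 else 0) + card {i \<in> W. i < v}"
    and "down_degree (insert 1 (insert n W)) E v = (if v \<le> r then 1 else 0) + card {i \<in> W. i < v}"
proof -
  have v: "2 \<le> v" "v < n" using assms by auto
  have fin: "finite W" using assms finite_subset by blast
  have adj: "E i v" if "i \<in> W" "i < v" for i
    using edge[of i v] that v assms by auto
  have "{i \<in> W. i < v \<and> E i v} = {i \<in> W. i < v}" "{i \<in> insert n W. i < v \<and> E i v} = {i \<in> W. i < v}"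
    using adj v by auto
  then show "down_degree W E v = card {i \<in> W. i < v}" "down_degree (insert n W) E v = card {i \<in> W. i < v}"
    by (simp_all add: down_degree_def)
  have 1: "{i \<in> insert 1 W. i < v \<and> E i v} = (if v \<le> r then insert 1 {i \<in> W. i < v} else {i \<in> W. i < v})"
    using adj v edge[of 1 v] by auto
  have 2: "{i \<in> insert 1 (insert n W). i < v \<and> E i v} = {i \<in> insert 1 W. i < v \<and> E i v}"
    using v by auto
  have "1 \<notin> W" using assms by auto
  with 1 2 fin show "down_degree (insert 1 W) E v = (if v \<le> r then 1 else 0) + card {i \<in> W. i < v}"
    "down_degree (insert 1 (insert n W)) E v = (if v \<le> r then 1 else 0) + card {i \<in> W. i < v}"
    unfolding down_degree_def by simp_all
qed

lemma down_degree_ends: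
  assumes "W \<subseteq> {2..<n}"
  shows "down_degree (insert n W) E n = card (block W s n)"
    and "down_degree (insert 1 W) E 1 = 0"
    and "down_degree (insert 1 (insert n W)) E n = card (block W s n)"
    and "down_degree (insert 1 (insert n W)) E 1 = 0"
proof -
  have "E i n \<longleftrightarrow> s < i" if "i \<in> W" for i
    using edge[of i n] that assms by auto
  then have 1: "{i \<in> insert n W. i < n \<and> E i n} = block W s n"
    using assms by (auto simp: block_def)
  have "\<not> E 1 n" using edge[of 1 n] sr by auto
  then have 2: "{i \<in> insert 1 (insert n W). i < n \<and> E i n} = {i \<in> insert n W. i < n \<and> E i n}"
    by auto
  have "{i \<in> insert 1 W. i < 1 \<and> E i 1} = {}" "{i \<in> insert 1 (insert n W). i < 1 \<and> E i 1} = {}"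
    using assms sr by auto
  with 1 2 show "down_degree (insert n W) E n = card (block W s n)" "down_degree (insert 1 W) E 1 = 0"
    "down_degree (insert 1 (insert n W)) E n = card (block W s n)" "down_degree (insert 1 (insert n W)) E 1 = 0"
    unfolding down_degree_def by simp_all
qed

text \<open>W is any subset of the inner vertices, so that the induction deletes vertices without
  relabelling. A squared colour would need two nonadjacent vertices, hence the value 0 for d >
  0.\<close>

lemma chrom_clique:
  assumes "W \<subseteq> {2..<n}" "col_content \<alpha> e d" "e + 2 * d = card W"
  shows "chrom_qsf W E \<alpha> = (if d = 0 then qfact (card W) else 0)"
  using assms
proof (induction "card W" arbitrary: W \<alpha> e d)
  case 0
  then have "W = {}" using finite_subset by fastforce
  moreover have "\<alpha> = (\<lambda>_. 0)" "d = 0" using 0 col_content_zero by auto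
  ultimately show ?case by (simp add: chrom_qsf_empty qfact_def)
next
  case (Suc k)
  have fin: "finite W" using Suc.prems finite_subset by blast
  have "0 < e + 2 * d" using Suc by simp
  with Suc.prems(2) show ?case
  proof (cases rule: col_content_top)
    case (1 c)
    have "chrom_qsf (W - {v}) E (\<alpha>(c := 0)) = (if d = 0 then qfact k else 0)" if "v \<in> W" for v
    proof -
      have k: "k = card (W - {v})" using Suc.hyps(2) that fin by simp
      moreover have "W - {v} \<subseteq> {2..<n}" using Suc.prems(1) by blast
      moreover have "e - 1 + 2 * d = card (W - {v})" using Suc.prems(3) Suc.hyps(2) 1(3) k by linarith
      ultimately show ?thesis using Suc.hyps(1)[OF _ _ 1(4)] by metis
    qed
    then have "chrom_qsf W E \<alpha> = (\<Sum>v\<in>W. [:0, 1:] ^ card {i \<in> W. i < v} * (if d = 0 then qfact k else 0))"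
      unfolding chrom_qsf_top_single[OF fin 1(1,2) irrefl]
      by (intro sum.cong) (simp_all add: down_degree_inner[OF Suc.prems(1)])
    then show ?thesis
      unfolding sum_distrib_right[symmetric] sum_rank[OF fin] using Suc.hyps(2) qfact_Suc[of k] by auto
  next
    case (2 c)
    have none: "{(u, v). u \<in> W \<and> v \<in> W \<and> u < v \<and> \<not> E u v} = {}"
    proof -
      have "E u v" if "u \<in> W" "v \<in> W" "u < v" for u v
      proof -
        have "2 \<le> u" "v < n" using that Suc.prems(1) by auto
        then show ?thesis using edge[of u v] that by auto
      qed
      then show ?thesis by auto
    qed
    have "chrom_qsf W E \<alpha> = 0"
      unfolding chrom_qsf_top_pair[OF fin 2(1,2) irrefl sym] none by simp
    then show ?thesis using 2(3) by simp
  qed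
qed

lemma chrom_right:
  assumes "W \<subseteq> {2..<n}" "col_content \<alpha> e d" "e + 2 * d = card W + 1"
  shows "chrom_qsf (insert n W) E \<alpha> = one_end_poly d (card (block W 0 s)) (card (block W s n))"
  using assms
proof (induction "card W" arbitrary: W \<alpha> e d rule: less_induct)
  case less
  note W = less.prems(1)
  let ?a = "card (block W 0 s)" and ?b = "card (block W s n)"
  have fin: "finite W" "finite (insert n W)" using W finite_subset by auto
  have nW: "n \<notin> W" using W by auto
  have card: "card W = ?a + ?b" using card_blocks[OF W] by simp
  have "0 < e + 2 * d" using less by simp
  with less.prems(2) show ?case
  proof (cases rule: col_content_top)
    case (1 c)
    let ?F = "\<lambda>v. chrom_qsf (insert n W - {v}) E (\<alpha>(c := 0))"
    have IH: "?F v = one_end_poly d (card (block (W - {v}) 0 s)) (card (block (W - {v}) s n))" if "v \<in> W" for v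
    proof -
      have "insert n W - {v} = insert n (W - {v})" using that nW by auto
      moreover have c: "card (W - {v}) + 1 = card W" using that fin by (metis Suc_eq_plus1 card_Suc_Diff1)
      moreover have "W - {v} \<subseteq> {2..<n}" using W by blast
      moreover have "e - 1 + 2 * d = card (W - {v}) + 1" using less.prems(3) 1(3) c by linarith
      ultimately show ?thesis using less.hyps[OF _ _ 1(4)] by (metis less_add_one)
    qed
    have Fn: "?F n = (if d = 0 then qfact (?a + ?b) else 0)"
    proof -
      have "insert n W - {n} = W" using nW by auto
      then show ?thesis using chrom_clique[OF W 1(4)] less.prems(3) 1(3) card by simp
    qed
    have S1: "(\<Sum>v\<in>block W 0 s. [:0, 1:] ^ down_degree (insert n W) E v * ?F v)
        = [:0, 1:] ^ (0 + card {i \<in> W. i \<le> 0}) * (qint ?a * one_end_poly d (?a - 1) ?b)"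
      using down_degree_inner(2)[OF W] IH card_block_remove[OF fin(1)]
      by (intro sum_block_rank[OF W]) (simp_all add: block_def)
    have S2: "(\<Sum>v\<in>block W s n. [:0, 1:] ^ down_degree (insert n W) E v * ?F v)
        = [:0, 1:] ^ (0 + card {i \<in> W. i \<le> s}) * (qint ?b * one_end_poly d ?a (?b - 1))"
      using down_degree_inner(2)[OF W] IH card_block_remove[OF fin(1)]
      by (intro sum_block_rank[OF W]) (simp_all add: block_def)
    have lt: "2 * d < ?a + ?b + 1" using less.prems(3) 1(3) card by linarith
    have "chrom_qsf (insert n W) E \<alpha> = (\<Sum>v\<in>insert n W. [:0, 1:] ^ down_degree (insert n W) E v * ?F v)"
      by (rule chrom_qsf_top_single[OF fin(2) 1(1,2) irrefl])
    also have "\<dots> = [:0, 1:] ^ down_degree (insert n W) E n * ?F n + (\<Sum>v\<in>W. [:0, 1:] ^ down_degree (insert n W) E v * ?F v)"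
      by (rule sum.insert[OF fin(1) nW])
    also have "\<dots> = one_end_poly d ?a ?b"
      unfolding one_end_poly_step(1)[OF lt] sum_blocks(3)[OF W] S1 S2 Fn down_degree_ends[OF W] card_blocks(2,3)[OF W] add_0 power_0 mult_1
      by (simp only: ac_simps)
    finally show ?thesis .
  next
    case (2 c)
    \<comment> \<open>A class of size two consists of n and a nonneighbour, that is, a vertex of the
      first block.\<close>
    have pairs: "{(u, v). u \<in> insert n W \<and> v \<in> insert n W \<and> u < v \<and> \<not> E u v} = (\<lambda>u. (u, n)) ` block W 0 s"
    proof -
      have "u \<in> insert n W \<and> v \<in> insert n W \<and> u < v \<and> \<not> E u v \<longleftrightarrow> v = n \<and> u \<in> block W 0 s" for u v
        using edge[of u v] W sr by (force simp: block_def)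
      then show ?thesis by auto
    qed
    let ?F = "\<lambda>u. chrom_qsf (insert n W - {u, n}) E (\<alpha>(c := 0))"
    have IH: "?F u = (if d - 1 = 0 then qfact (card W - 1) else 0)" if "u \<in> W" for u
    proof -
      have eq: "insert n W - {u, n} = W - {u}" using nW by auto
      have c: "card (W - {u}) + 1 = card W" using that fin by (metis Suc_eq_plus1 card_Suc_Diff1)
      have "chrom_qsf (W - {u}) E (\<alpha>(c := 0)) = (if d - 1 = 0 then qfact (card (W - {u})) else 0)"
        using W less.prems(3) 2(3,4) c by (intro chrom_clique[of _ _ e]) auto
      then show ?thesis unfolding eq using c by (metis add_diff_cancel_right')
    qed
    have "chrom_qsf (insert n W) E \<alpha> = (\<Sum>u\<in>block W 0 s. [:0, 1:] ^ (down_degree (insert n W) E u + down_degree (insert n W) E n) * ?F u)"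
      unfolding chrom_qsf_top_pair[OF fin(2) 2(1,2) irrefl sym] pairs
      by (subst sum.reindex) (auto simp: inj_on_def)
    also have "\<dots> = [:0, 1:] ^ ?b * (\<Sum>u\<in>block W 0 s. [:0, 1:] ^ down_degree (insert n W) E u * ?F u)"
      by (simp only: down_degree_ends(1)[OF W] power_add sum_distrib_left mult_ac)
    also have "(\<Sum>u\<in>block W 0 s. [:0, 1:] ^ down_degree (insert n W) E u * ?F u)
        = [:0, 1:] ^ (0 + card {i \<in> W. i \<le> 0}) * (qint ?a * (if d - 1 = 0 then qfact (card W - 1) else 0))"
      using down_degree_inner(2)[OF W] IH
      by (intro sum_block_rank[OF W]) (simp_all add: block_def)
    finally have chrom: "chrom_qsf (insert n W) E \<alpha> = [:0, 1:] ^ ?b *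
        ([:0, 1:] ^ (0 + card {i \<in> W. i \<le> 0}) * (qint ?a * (if d - 1 = 0 then qfact (card W - 1) else 0)))" .
    show ?thesis
      unfolding chrom card_blocks(2)[OF W] card using 2(3) by (auto simp: one_end_poly_def mult_ac)
  qed
qed

text \<open>Mirror image of \<open>chrom_right\<close>: the nonneighbours now form the last block,
  and since vertex 1 lies below its neighbours, the second recursion of
  \<open>one_end_poly_step\<close> applies.\<close>

lemma chrom_left:
  assumes "W \<subseteq> {2..<n}" "col_content \<alpha> e d" "e + 2 * d = card W + 1"
  shows "chrom_qsf (insert 1 W) E \<alpha> = one_end_poly d (card (block W r n)) (card (block W 0 r))"
  using assms
proof (induction "card W" arbitrary: W \<alpha> e d rule: less_induct)
  case less
  note W = less.prems(1)
  let ?k = "card (block W r n)" and ?b = "card (block W 0 r)"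
  have fin: "finite W" "finite (insert 1 W)" using W finite_subset by auto
  have nW: "1 \<notin> W" using W by auto
  have b: "?b = card (block W 0 s) + card (block W s r)" using card_block_add[OF fin(1), of 0 s r] sr by simp
  have card: "card W = ?k + ?b" using card_blocks[OF W] b by simp
  have "0 < e + 2 * d" using less by simp
  with less.prems(2) show ?case
  proof (cases rule: col_content_top)
    case (1 c)
    let ?F = "\<lambda>v. chrom_qsf (insert 1 W - {v}) E (\<alpha>(c := 0))"
    have IH: "?F v = one_end_poly d (card (block (W - {v}) r n)) (card (block (W - {v}) 0 r))" if "v \<in> W" for v
    proof -
      have "insert 1 W - {v} = insert 1 (W - {v})" using that nW by auto
      moreover have c: "card (W - {v}) + 1 = card W" using that fin by (metis Suc_eq_plus1 card_Suc_Diff1)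
      moreover have "W - {v} \<subseteq> {2..<n}" using W by blast
      moreover have "e - 1 + 2 * d = card (W - {v}) + 1" using less.prems(3) 1(3) c by linarith
      ultimately show ?thesis using less.hyps[OF _ _ 1(4)] by (metis less_add_one)
    qed
    have Fn: "?F 1 = (if d = 0 then qfact (?k + ?b) else 0)"
    proof -
      have "insert 1 W - {1} = W" using nW by auto
      then show ?thesis using chrom_clique[OF W 1(4)] less.prems(3) 1(3) card by simp
    qed
    have S1: "(\<Sum>v\<in>block W 0 r. [:0, 1:] ^ down_degree (insert 1 W) E v * ?F v)
        = [:0, 1:] ^ (1 + card {i \<in> W. i \<le> 0}) * (qint ?b * one_end_poly d ?k (?b - 1))"
      using down_degree_inner(3)[OF W] IH card_block_remove[OF fin(1)]
      by (intro sum_block_rank[OF W]) (simp_all add: block_def)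
    have S2: "(\<Sum>v\<in>block W r n. [:0, 1:] ^ down_degree (insert 1 W) E v * ?F v)
        = [:0, 1:] ^ (0 + card {i \<in> W. i \<le> r}) * (qint ?k * one_end_poly d (?k - 1) ?b)"
      using down_degree_inner(3)[OF W] IH card_block_remove[OF fin(1)]
      by (intro sum_block_rank[OF W]) (simp_all add: block_def)
    have lt: "2 * d < ?k + ?b + 1" using less.prems(3) 1(3) card by linarith
    have "chrom_qsf (insert 1 W) E \<alpha> = (\<Sum>v\<in>insert 1 W. [:0, 1:] ^ down_degree (insert 1 W) E v * ?F v)"
      by (rule chrom_qsf_top_single[OF fin(2) 1(1,2) irrefl])
    also have "\<dots> = [:0, 1:] ^ down_degree (insert 1 W) E 1 * ?F 1 + (\<Sum>v\<in>W. [:0, 1:] ^ down_degree (insert 1 W) E v * ?F v)"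
      by (rule sum.insert[OF fin(1) nW])
    also have "\<dots> = one_end_poly d ?k ?b"
      unfolding one_end_poly_step(2)[OF lt] sum_blocks(4)[OF W] S1 S2 Fn down_degree_ends[OF W] card_blocks(2,4)[OF W] b[symmetric]
        add_0 add_0_right power_0 power_one_right mult_1
      by (simp only: ac_simps)
    finally show ?thesis .
  next
    case (2 c)
    have pairs: "{(u, v). u \<in> insert 1 W \<and> v \<in> insert 1 W \<and> u < v \<and> \<not> E u v} = (\<lambda>v. (1, v)) ` block W r n"
    proof -
      have "u \<in> insert 1 W \<and> v \<in> insert 1 W \<and> u < v \<and> \<not> E u v \<longleftrightarrow> u = 1 \<and> v \<in> block W r n" (is "?l \<longleftrightarrow> ?r") for u v
      proof
        assume l: ?l
        then have "1 \<le> u" "v < n" using W sr by auto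
        then have "u = 1 \<and> r < v" using edge[of u v] l by auto
        then show ?r using l \<open>v < n\<close> by (auto simp: block_def)
      next
        assume r: ?r
        then have "v \<in> W" "v < n" "1 < v" "r < v" using W by (auto simp: block_def)
        then show ?l using edge[of u v] r by auto
      qed
      then show ?thesis by auto
    qed
    let ?F = "\<lambda>v. chrom_qsf (insert 1 W - {1, v}) E (\<alpha>(c := 0))"
    have IH: "?F u = (if d - 1 = 0 then qfact (card W - 1) else 0)" if "u \<in> W" for u
    proof -
      have eq: "insert 1 W - {1, u} = W - {u}" using nW by auto
      have c: "card (W - {u}) + 1 = card W" using that fin by (metis Suc_eq_plus1 card_Suc_Diff1)
      have "chrom_qsf (W - {u}) E (\<alpha>(c := 0)) = (if d - 1 = 0 then qfact (card (W - {u})) else 0)"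
        using W less.prems(3) 2(3,4) c by (intro chrom_clique[of _ _ e]) auto
      then show ?thesis unfolding eq using c by (metis add_diff_cancel_right')
    qed
    have "chrom_qsf (insert 1 W) E \<alpha> = (\<Sum>v\<in>block W r n. [:0, 1:] ^ (down_degree (insert 1 W) E 1 + down_degree (insert 1 W) E v) * ?F v)"
      unfolding chrom_qsf_top_pair[OF fin(2) 2(1,2) irrefl sym] pairs
      by (subst sum.reindex) (auto simp: inj_on_def)
    also have "\<dots> = (\<Sum>v\<in>block W r n. [:0, 1:] ^ down_degree (insert 1 W) E v * ?F v)"
      by (simp only: down_degree_ends(2)[OF W] add_0)
    also have "\<dots> = [:0, 1:] ^ (0 + card {i \<in> W. i \<le> r}) * (qint ?k * (if d - 1 = 0 then qfact (card W - 1) else 0))"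
      using down_degree_inner(3)[OF W] IH
      by (intro sum_block_rank[OF W]) (simp_all add: block_def)
    finally have chrom: "chrom_qsf (insert 1 W) E \<alpha> =
        [:0, 1:] ^ (0 + card {i \<in> W. i \<le> r}) * (qint ?k * (if d - 1 = 0 then qfact (card W - 1) else 0))" .
    show ?thesis
      unfolding chrom card_blocks(4)[OF W] card b[symmetric] using 2(3) by (auto simp: one_end_poly_def mult_ac)
  qed
qed

lemma chrom_both:
  assumes "W \<subseteq> {2..<n}" "col_content \<alpha> e d" "e + 2 * d = card W + 2"
  shows "chrom_qsf (insert 1 (insert n W)) E \<alpha> = two_ends_poly d (card (block W 0 s)) (card (block W s r)) (card (block W r n))"
  using assms
proof (induction "card W" arbitrary: W \<alpha> e d rule: less_induct)
  case less
  note W = less.prems(1)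
  let ?V = "insert 1 (insert n W)"
  let ?a = "card (block W 0 s)" and ?b = "card (block W s r)" and ?k = "card (block W r n)"
  have fin: "finite W" "finite (insert n W)" "finite ?V" using W finite_subset by auto
  have ends: "1 \<notin> insert n W" "n \<notin> W" using W sr by auto
  have ab: "card (block W 0 r) = ?a + ?b" using card_block_add[OF fin(1), of 0 s r] sr by simp
  note bk = card_blocks(5)[OF W]
  have card: "card W = ?a + ?b + ?k" using card_blocks[OF W] by simp
  have "0 < e + 2 * d" using less by simp
  with less.prems(2) show ?case
  proof (cases rule: col_content_top)
    case (1 c)
    let ?F = "\<lambda>v. chrom_qsf (?V - {v}) E (\<alpha>(c := 0))"
    have IH: "?F v = two_ends_poly d (card (block (W - {v}) 0 s)) (card (block (W - {v}) s r)) (card (block (W - {v}) r n))"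
      if "v \<in> W" for v
    proof -
      have "?V - {v} = insert 1 (insert n (W - {v}))" using that ends by auto
      moreover have c: "card (W - {v}) + 1 = card W" using that fin by (metis Suc_eq_plus1 card_Suc_Diff1)
      moreover have "W - {v} \<subseteq> {2..<n}" using W by blast
      moreover have "e - 1 + 2 * d = card (W - {v}) + 2" using less.prems(3) 1(3) c by linarith
      ultimately show ?thesis using less.hyps[OF _ _ 1(4)] by (metis less_add_one)
    qed
    \<comment> \<open>Without vertex 1 the middle and last blocks merge: all their vertices are
      neighbours of n.\<close>
    have F1: "?F 1 = one_end_poly d ?a (?b + ?k)"
    proof -
      have "?V - {1} = insert n W" using ends by auto
      then show ?thesis using chrom_right[OF W 1(4)] less.prems(3) 1(3) bk by simp
    qed
    \<comment> \<open>Without vertex n the first and middle blocks merge into the neighbours of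
      1.\<close>
    have Fn: "?F n = one_end_poly d ?k (?a + ?b)"
    proof -
      have "?V - {n} = insert 1 W" using ends by auto
      then show ?thesis using chrom_left[OF W 1(4)] less.prems(3) 1(3) ab by simp
    qed
    have S1: "(\<Sum>v\<in>block W 0 s. [:0, 1:] ^ down_degree ?V E v * ?F v)
        = [:0, 1:] ^ (1 + card {i \<in> W. i \<le> 0}) * (qint ?a * two_ends_poly d (?a - 1) ?b ?k)"
      using down_degree_inner(4)[OF W] IH card_block_remove[OF fin(1)] sr
      by (intro sum_block_rank[OF W]) (simp_all add: block_def)
    have S2: "(\<Sum>v\<in>block W s r. [:0, 1:] ^ down_degree ?V E v * ?F v)
        = [:0, 1:] ^ (1 + card {i \<in> W. i \<le> s}) * (qint ?b * two_ends_poly d ?a (?b - 1) ?k)"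
      using down_degree_inner(4)[OF W] IH card_block_remove[OF fin(1)] sr
      by (intro sum_block_rank[OF W]) (simp_all add: block_def)
    have S3: "(\<Sum>v\<in>block W r n. [:0, 1:] ^ down_degree ?V E v * ?F v)
        = [:0, 1:] ^ (0 + card {i \<in> W. i \<le> r}) * (qint ?k * two_ends_poly d ?a ?b (?k - 1))"
      using down_degree_inner(4)[OF W] IH card_block_remove[OF fin(1)] sr
      by (intro sum_block_rank[OF W]) (simp_all add: block_def)
    have lt: "2 * d < ?a + ?b + ?k + 2" using less.prems(3) 1(3) card by linarith
    have "chrom_qsf ?V E \<alpha> = (\<Sum>v\<in>?V. [:0, 1:] ^ down_degree ?V E v * ?F v)"
      by (rule chrom_qsf_top_single[OF fin(3) 1(1,2) irrefl])
    also have "\<dots> = [:0, 1:] ^ down_degree ?V E 1 * ?F 1 + ([:0, 1:] ^ down_degree ?V E n * ?F n + (\<Sum>v\<in>W. [:0, 1:] ^ down_degree ?V E v * ?F v))"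
      by (simp only: sum.insert[OF fin(2) ends(1)] sum.insert[OF fin(1) ends(2)])
    also have "\<dots> = two_ends_poly d ?a ?b ?k"
      unfolding two_ends_poly_step[OF lt] sum_blocks(1)[OF W] S1 S2 S3 F1 Fn down_degree_ends[OF W] card_blocks(2,3,4)[OF W] bk
        add_0 add_0_right power_0 mult_1
      by (simp only: power_add power_Suc power_one_right ac_simps)
    finally show ?thesis .
  next
    case (2 c)
    let ?P = "(\<lambda>v. (1, v)) ` block W r n" and ?Q = "(\<lambda>u. (u, n)) ` block W 0 s"
    have pairs: "{(u, v). u \<in> ?V \<and> v \<in> ?V \<and> u < v \<and> \<not> E u v} = insert (1, n) (?P \<union> ?Q)"
    proof -
      have "u \<in> ?V \<and> v \<in> ?V \<and> u < v \<and> \<not> E u v \<longleftrightarrow>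
          u = 1 \<and> v = n \<or> u = 1 \<and> v \<in> block W r n \<or> v = n \<and> u \<in> block W 0 s" (is "?l \<longleftrightarrow> ?r") for u v
      proof
        assume l: ?l
        then have uv: "1 \<le> u" "v \<le> n" "u < v" using W sr by auto
        then have "u = 1 \<and> r < v \<or> v = n \<and> u \<le> s" using edge[of u v] l by auto
        then show ?r using l uv by (auto simp: block_def)
      next
        assume r: ?r
        have "v < n" "r < v" if "v \<in> block W r n" for v using that W by (auto simp: block_def)
        moreover have "1 < u" "u < n" "u \<le> s" if "u \<in> block W 0 s" for u using that W by (auto simp: block_def)
        ultimately have "1 \<le> u \<and> u < v \<and> v \<le> n \<and> (u = 1 \<and> r < v \<or> v = n \<and> u \<le> s)"
          using r sr by force
        then show ?l using edge[of u v] r by (auto simp: block_def)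
      qed
      then show ?thesis by auto
    qed
    let ?G = "\<lambda>(u, v). [:0, 1:] ^ (down_degree ?V E u + down_degree ?V E v) * chrom_qsf (?V - {u, v}) E (\<alpha>(c := 0))"
    let ?F = "\<lambda>v. chrom_qsf (?V - {1, v}) E (\<alpha>(c := 0))"
    let ?H = "\<lambda>u. chrom_qsf (?V - {u, n}) E (\<alpha>(c := 0))"
    have F: "?F v = one_end_poly (d - 1) (card (block (W - {v}) 0 s)) (card (block (W - {v}) s n))" if "v \<in> W" for v
    proof -
      have eq: "?V - {1, v} = insert n (W - {v})" using ends that by auto
      have c: "card (W - {v}) + 1 = card W" using that fin by (metis Suc_eq_plus1 card_Suc_Diff1)
      then show ?thesis unfolding eq
        using W less.prems(3) 2(3,4) by (intro chrom_right[of _ _ e]) auto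
    qed
    have H: "?H v = one_end_poly (d - 1) (card (block (W - {v}) r n)) (card (block (W - {v}) 0 r))" if "v \<in> W" for v
    proof -
      have eq: "?V - {v, n} = insert 1 (W - {v})" using ends that by auto
      have c: "card (W - {v}) + 1 = card W" using that fin by (metis Suc_eq_plus1 card_Suc_Diff1)
      then show ?thesis unfolding eq
        using W less.prems(3) 2(3,4) by (intro chrom_left[of _ _ e]) auto
    qed
    have N: "chrom_qsf (?V - {1, n}) E (\<alpha>(c := 0)) = (if d = 1 then qfact (card W) else 0)"
    proof -
      have eq: "?V - {1, n} = W" using ends by auto
      have "d - 1 = 0 \<longleftrightarrow> d = 1" using 2(3) by auto
      then show ?thesis unfolding eq
        using chrom_clique[OF W 2(4)] less.prems(3) 2(3) by simp
    qed
    have S1: "(\<Sum>v\<in>block W r n. [:0, 1:] ^ down_degree ?V E v * ?F v)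
        = [:0, 1:] ^ (0 + card {i \<in> W. i \<le> r}) * (qint ?k * one_end_poly (d - 1) ?a (?b + ?k - 1))"
      using down_degree_inner(4)[OF W] F card_block_remove[OF fin(1)] sr bk
      by (intro sum_block_rank[OF W]) (simp_all add: block_def)
    have S2: "(\<Sum>v\<in>block W 0 s. [:0, 1:] ^ down_degree ?V E v * ?H v)
        = [:0, 1:] ^ (1 + card {i \<in> W. i \<le> 0}) * (qint ?a * one_end_poly (d - 1) ?k (?a + ?b - 1))"
      using down_degree_inner(4)[OF W] H card_block_remove[OF fin(1)] sr ab
      by (intro sum_block_rank[OF W]) (simp_all add: block_def)
    have fPQ: "finite ?P" "finite ?Q" "finite (?P \<union> ?Q)" using fin by (auto simp: block_def)
    have dPQ: "?P \<inter> ?Q = {}" "(1, n) \<notin> ?P \<union> ?Q" using ends by (auto simp: block_def)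
    have "chrom_qsf ?V E \<alpha> = sum ?G (insert (1, n) (?P \<union> ?Q))"
      unfolding chrom_qsf_top_pair[OF fin(3) 2(1,2) irrefl sym] pairs by (rule refl)
    also have "\<dots> = ?G (1, n) + (sum ?G ?P + sum ?G ?Q)"
      by (simp only: sum.insert[OF fPQ(3) dPQ(2)] sum.union_disjoint[OF fPQ(1,2) dPQ(1)])
    also have "sum ?G ?P = (\<Sum>v\<in>block W r n. [:0, 1:] ^ down_degree ?V E v * ?F v)"
      by (subst sum.reindex) (use down_degree_ends(4)[OF W] in \<open>auto simp: inj_on_def\<close>)
    also have "sum ?G ?Q = [:0, 1:] ^ (?b + ?k) * (\<Sum>u\<in>block W 0 s. [:0, 1:] ^ down_degree ?V E u * ?H u)"
      by (subst sum.reindex)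
        (use down_degree_ends(3)[OF W] bk in \<open>auto simp: inj_on_def sum_distrib_left power_add mult_ac\<close>)
    finally have chrom: "chrom_qsf ?V E \<alpha> = [:0, 1:] ^ (down_degree ?V E 1 + down_degree ?V E n) * chrom_qsf (?V - {1, n}) E (\<alpha>(c := 0))
        + ((\<Sum>v\<in>block W r n. [:0, 1:] ^ down_degree ?V E v * ?F v)
        + [:0, 1:] ^ (?b + ?k) * (\<Sum>u\<in>block W 0 s. [:0, 1:] ^ down_degree ?V E u * ?H u))" by (simp only: prod.case)
    have d1: "1 \<le> d" using 2(3) by simp
    show ?thesis
      unfolding chrom S1 S2 N two_ends_poly_pair[OF d1] down_degree_ends[OF W] card_blocks(2,4)[OF W] bk card power_add
      by (simp add: algebra_simps)
  qed
qed

end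

section \<open>The monomials that occur in the full graph\<close>

context clique_with_ends
begin

text \<open>An inner vertex i is adjacent to all other inner vertices and, because s <= r, to at
  least one end: to 1 if i <= r, to n otherwise. Only the other end can join it.\<close>

lemma card_independent_le_2:
  assumes "C \<subseteq> {1..n}" "\<And>i j. i \<in> C \<Longrightarrow> j \<in> C \<Longrightarrow> \<not> E i j"
  shows "card C \<le> 2"
proof -
  have "\<exists>x y. C \<subseteq> {x, y}"
  proof (cases "C \<subseteq> {1, n}")
    case False
    then obtain i where i: "i \<in> C" "i \<noteq> 1" "i \<noteq> n" by blast
    have in_range: "1 \<le> j" "j \<le> n" if "j \<in> C" for j using that assms(1) by auto
    have "j = i \<or> (if i \<le> r then j = n else j = 1)" if j: "j \<in> C" for j
    proof -
      have "\<not> E i j" "\<not> E j i" using assms(2) i(1) j by blast+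
      then show ?thesis
        using edge[of i j] edge[of j i] in_range[OF i(1)] in_range[OF j] i(2,3) sr
        by (cases "i < j"; cases "j < i") auto
    qed
    then have "C \<subseteq> {i, n} \<or> C \<subseteq> {i, 1}" by (cases "i \<le> r") (simp_all, blast+)
    then show ?thesis by blast
  qed blast
  then obtain x y where "C \<subseteq> {x, y}" by blast
  then have "card C \<le> card {x, y}" by (intro card_mono) auto
  also have "\<dots> \<le> 2" by (simp add: card_insert_if)
  finally show ?thesis .
qed

lemma chrom_nonzero_col_content:
  assumes "chrom_qsf {1..n} E \<alpha> \<noteq> 0"
  shows "\<exists>e d. col_content \<alpha> e d \<and> e + 2 * d = n"
proof -
  obtain \<kappa> where k: "\<kappa> \<in> colorings {1..n} E \<alpha>"
    using assms unfolding chrom_qsf_colorings by (meson sum.not_neutral_contains_not_neutral)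
  let ?C = "\<lambda>c. {v \<in> {1..n}. \<kappa> v = c}"
  have cls: "card (?C c) = \<alpha> c" for c using k by (simp add: colorings_def)
  have supp: "{c. \<alpha> c \<noteq> 0} = \<kappa> ` {1..n}"
  proof
    show "{c. \<alpha> c \<noteq> 0} \<subseteq> \<kappa> ` {1..n}"
    proof
      fix c assume "c \<in> {c. \<alpha> c \<noteq> 0}"
      then have "card (?C c) \<noteq> 0" using cls by simp
      then have "?C c \<noteq> {}" by (metis card.empty)
      then show "c \<in> \<kappa> ` {1..n}" by blast
    qed
    show "\<kappa> ` {1..n} \<subseteq> {c. \<alpha> c \<noteq> 0}"
      using coloring_in_support[OF _ k] by blast
  qed
  have proper: "proper_col {1..n} E \<kappa>" using k by (simp add: colorings_def)
  have "\<alpha> c \<le> 2" for c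
  proof -
    have "\<not> E i j" if "i \<in> ?C c" "j \<in> ?C c" for i j
    proof -
      have "i \<in> {1..n}" "j \<in> {1..n}" "\<kappa> i = \<kappa> j" using that by auto
      then show ?thesis using proper unfolding proper_col_def by blast
    qed
    then have "card (?C c) \<le> 2" by (intro card_independent_le_2) auto
    then show ?thesis using cls by simp
  qed
  then have c: "col_content \<alpha> (card {c. \<alpha> c = 1}) (card {c. \<alpha> c = 2})"
    unfolding col_content_def supp by simp
  have "n = (\<Sum>c\<in>\<kappa> ` {1..n}. \<Sum>v\<in>?C c. 1)"
    using sum.image_gen[of "{1..n}" "\<lambda>_. 1 :: nat" \<kappa>] by simp
  also have "\<dots> = (\<Sum>c | \<alpha> c \<noteq> 0. \<alpha> c)"
    unfolding supp using cls by simp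
  finally show ?thesis using sum_col_content[OF c] c by metis
qed

lemma chrom_full:
  assumes "col_content \<alpha> e d" "e + 2 * d = n"
  shows "chrom_qsf {1..n} E \<alpha> = two_ends_poly d (s - 1) (r - s) (n - 1 - r)"
proof -
  have n: "{1..n} = insert 1 (insert n {2..<n})" using sr by auto
  have "card ({2..<n}) + 2 = n" using sr by simp
  moreover have "block {2..<n} 0 s = {2..s}" "block {2..<n} s r = {s<..r}" "block {2..<n} r n = {r<..<n}"
    using sr by (auto simp: block_def)
  ultimately show ?thesis
    unfolding n using chrom_both[OF subset_refl assms(1)] assms(2) by simp
qed

end

section \<open>Expansion in elementary symmetric functions\<close>

text \<open>The shifted parameters turn the differences of n, r, s in the coefficients into sums.
  Equality is tested at each monomial, where only the number d of squared variables matters.\<close>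

lemma chrom_qsf_elementary:
  fixes E :: "nat \<Rightarrow> nat \<Rightarrow> bool" and i b j :: nat
  assumes "clique_with_ends E (i + 2) (i + b + 2) (i + b + j + 4)"
  defines "n \<equiv> i + b + j + 4"
  shows "chrom_qsf {1..n} E = (\<lambda>\<alpha>. qfact (i + b + j) *
     (  (qint n * qint (i + b + j + 1) * qint (i + b + 1) * qint (b + j + 1)) * elem_part [n] \<alpha>
      + smult (1 / 2) (qint (i + b + j + 2) *
        (([:0, 1:] ^ (i + b + 1) + [:0, 1:] ^ (b + j + 1)) * qint (i + b + j + 1)
         + [:0, 1:] ^ (b + j + 1) * qint 2 * qint (i + b) * qint (i + 1)
         + [:0, 1:] ^ (i + b + 1) * qint 2 * qint (j + 1) * qint (b + j))) * elem_part [n - 1, 1] \<alpha>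
      + ([:0, 1:] ^ (i + 2 * b + j + 1) * qint 2 * qint (j + 1) * qint (i + 1)) * elem_part [n - 2, 2] \<alpha>))"
    (is "_ = (\<lambda>\<alpha>. ?q * (?Cn * _ + ?C1 * _ + ?C2 * _))")
proof
  interpret clique_with_ends E "i + 2" "i + b + 2" n using assms by simp
  fix \<alpha>
  show "chrom_qsf {1..n} E \<alpha> = ?q * (?Cn * elem_part [n] \<alpha> + ?C1 * elem_part [n - 1, 1] \<alpha> + ?C2 * elem_part [n - 2, 2] \<alpha>)"
  proof (cases "\<exists>e d. col_content \<alpha> e d \<and> e + 2 * d = n")
    case False
    then have "chrom_qsf {1..n} E \<alpha> = 0" using chrom_nonzero_col_content by blast
    moreover have "elem_part [n] \<alpha> = (0 :: rat poly)"
    proof -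
      have "\<not> col_content \<alpha> n 0" using False by (metis add_0_right mult_0_right)
      then show ?thesis by (simp add: elem_part_single elem_col_content)
    qed
    moreover have "elem_part [k, l] \<alpha> = (0 :: rat poly)" if "k + l = n" for k l
    proof -
      have "esplit k l \<alpha> = {}"
      proof (rule equals0I)
        fix \<beta> assume "\<beta> \<in> esplit k l \<alpha>"
        from esplit_col_content[OF this] show False using False unfolding that by blast
      qed
      then show ?thesis by (simp add: elem_part_pair)
    qed
    ultimately show ?thesis by (simp add: n_def)
  next
    case True
    then obtain e d where c: "col_content \<alpha> e d" "e + 2 * d = n" by blast
    have "n - 1 - (i + b + 2) = Suc j" "i + 2 - 1 = Suc i" "i + b + 2 - (i + 2) = b"
      by (simp_all add: n_def)
    then have chrom: "chrom_qsf {1..n} E \<alpha> = two_ends_poly d (Suc i) b (Suc j)"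
      using chrom_full[OF c] by simp
    \<comment> \<open>For d = 0, 1, 2 the values are n, 1, 0 here and C(n,2), n - 2, 1 in
      \<open>e2\<close>.\<close>
    have e1: "elem_part [n - 1, 1] \<alpha> = (of_nat (if d \<le> 1 then e choose (1 - d) else 0) :: rat poly)"
      unfolding elem_part_pair using card_esplit[OF c(1), of "n - 1" 1] c(2) by (simp add: n_def)
    have e2: "elem_part [n - 2, 2] \<alpha> = (of_nat (if d \<le> 2 then e choose (2 - d) else 0) :: rat poly)"
      unfolding elem_part_pair using card_esplit[OF c(1), of "n - 2" 2] c(2) by (simp add: n_def)
    have e0: "elem_part [n] \<alpha> = (if d = 0 then 1 else 0 :: rat poly)"
      using c by (auto simp: elem_part_single elem_col_content col_content_def)
    have P2: "two_ends_poly2 (Suc i) b (Suc j) = ?q * ?C2" by (rule two_ends_poly2_expand)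
    have P1: "two_ends_poly1 (Suc i) b (Suc j) = ?q * (?C1 + of_nat (i + b + j + 2) * ?C2)" by (rule two_ends_poly1_expand)
    have P0: "two_ends_poly 0 (Suc i) b (Suc j) = ?q * ?Cn + of_nat n * two_ends_poly1 (Suc i) b (Suc j)
        - (of_nat (n * (i + b + j + 2)) - of_nat (n choose 2)) * two_ends_poly2 (Suc i) b (Suc j)"
      unfolding n_def by (rule pboth0_expand)
    consider "d = 0" | "d = 1" | "d = 2" | "d > 2" by linarith
    then show ?thesis
    proof cases
      case 1
      then have "e = n" using c by simp
      then show ?thesis unfolding chrom e0 e1 e2 1 P0 P1 P2 of_nat_mult by (simp add: algebra_simps)
    next
      case 2
      then have "e = i + b + j + 2" using c by (simp add: n_def)
      moreover have "two_ends_poly 1 (Suc i) b (Suc j) = two_ends_poly1 (Suc i) b (Suc j)" by (simp add: two_ends_poly_def)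
      ultimately show ?thesis unfolding chrom e0 e1 e2 2 by (simp add: P1 algebra_simps)
    next
      case 3
      moreover have "two_ends_poly 2 (Suc i) b (Suc j) = two_ends_poly2 (Suc i) b (Suc j)" by (simp add: two_ends_poly_def)
      ultimately show ?thesis unfolding chrom e0 e1 e2 3 by (simp add: P2 algebra_simps)
    next
      case 4
      then show ?thesis unfolding chrom e0 e1 e2 by (simp add: two_ends_poly_def)
    qed
  qed
qed

section \<open>Positivity and unimodality of the expansion\<close>

lemma e_pos_combination:
  assumes "4 \<le> n" "0 \<le> c0" "0 \<le> c1" "0 \<le> c2"
  shows "e_pos (\<lambda>\<alpha>. c0 * elem_part [n] \<alpha> + c1 * elem_part [n - 1, 1] \<alpha> + c2 * elem_part [n - 2, 2] \<alpha>)"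
  unfolding e_pos_def
proof (intro exI conjI)
  let ?L = "{[n], [n - 1, 1], [n - 2, 2]}"
  let ?c = "\<lambda>l. if l = [n] then c0 else if l = [n - 1, 1] then c1 else c2"
  show "finite ?L" by simp
  show "\<forall>l\<in>?L. is_partition l \<and> 0 \<le> ?c l"
    using assms by (auto simp: is_partition_def)
  show "(\<lambda>\<alpha>. c0 * elem_part [n] \<alpha> + c1 * elem_part [n - 1, 1] \<alpha> + c2 * elem_part [n - 2, 2] \<alpha>)
      = (\<lambda>\<alpha>. \<Sum>l\<in>?L. ?c l * elem_part l \<alpha>)"
    by (simp add: add.assoc)
qed

lemma e_unimodal_combination:
  assumes "4 \<le> n" and X: "X = (\<lambda>\<alpha>. p0 * elem_part [n] \<alpha> + p1 * elem_part [n - 1, 1] \<alpha> + p2 * elem_part [n - 2, 2] \<alpha>)"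
    and su: "sym_unimodal D p0" "sym_unimodal D p1" "sym_unimodal D p2" and "of_nat D = 2 * c"
  shows "e_positive X \<and> e_unimodal X c"
proof -
  \<comment> \<open>The elementary functions have natural numbers as coefficients, constant in t, so
    extracting the coefficient of t^i acts on p0, p1, p2 alone.\<close>
  have t: "tcoeff X i = (\<lambda>\<alpha>. coeff p0 i * elem_part [n] \<alpha> + coeff p1 i * elem_part [n - 1, 1] \<alpha> + coeff p2 i * elem_part [n - 2, 2] \<alpha>)" for i
  proof
    fix \<alpha>
    have 0: "elem_part [n] \<alpha> = (of_nat (elem n \<alpha>) :: 'a :: comm_semiring_1)"
      unfolding elem_part_single by (rule elem_nat)
    have m: "coeff (p * of_nat N) i = coeff p i * of_nat N" for p :: "rat poly" and N
      by (simp add: of_nat_poly)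
    show "tcoeff X i \<alpha> = coeff p0 i * elem_part [n] \<alpha> + coeff p1 i * elem_part [n - 1, 1] \<alpha> + coeff p2 i * elem_part [n - 2, 2] \<alpha>"
      unfolding tcoeff_def X 0 elem_part_pair coeff_add m ..
  qed
  have pos: "e_positive X"
    unfolding e_positive_def t using su by (intro allI e_pos_combination assms(1)) (simp_all add: sym_unimodal_def)
  have "tcoeff X i = (if i \<le> D then tcoeff X (D - i) else (\<lambda>_. 0))" for i
  proof (cases "i \<le> D")
    case True
    then have "coeff p0 (D - i) = coeff p0 i" "coeff p1 (D - i) = coeff p1 i" "coeff p2 (D - i) = coeff p2 i"
      using su by (simp_all add: sym_unimodal_def)
    then show ?thesis using True by (simp add: t)
  next
    case False
    then have "coeff p0 i = 0" "coeff p1 i = 0" "coeff p2 i = 0"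
      using su by (simp_all add: sym_unimodal_def)
    then show ?thesis using False by (simp add: t)
  qed
  moreover have "e_pos (\<lambda>\<alpha>. tcoeff X (Suc i) \<alpha> - tcoeff X i \<alpha>)" if "of_nat i < c" for i
  proof -
    have "(of_nat (2 * i) :: rat) < of_nat D" using that assms(6) by simp
    then have "2 * i < D" by (simp only: of_nat_less_iff)
    then have "0 \<le> coeff p0 (Suc i) - coeff p0 i" "0 \<le> coeff p1 (Suc i) - coeff p1 i" "0 \<le> coeff p2 (Suc i) - coeff p2 i"
      using su by (simp_all add: sym_unimodal_def)
    from e_pos_combination[OF assms(1) this] show ?thesis
      by (simp add: t algebra_simps)
  qed
  ultimately show ?thesis using pos assms(6) unfolding e_unimodal_def by blast
qed

lemma choose_two_plus_4: "(N + 4) choose 2 = (N choose 2) + 4 * N + 6"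
  by (simp add: numeral_eq_Suc)

text \<open>The factor t^(r-1) (1 + t^(n-r-s)) appears as t^(r-1) + t^(n-s-1), because n - r - s may
  be negative. The centre is half the number of edges: 1 has n - r nonneighbours, n has s, and the
  pair {1, n} is shared.\<close>

theorem theorem4p5:
  fixes n r s :: nat and m :: "nat \<Rightarrow> nat"
  assumes "2 \<le> s" and "s \<le> r" and "r + 2 \<le> n"
    and "m 1 = r"
    and "\<And>i. 2 \<le> i \<Longrightarrow> i \<le> s \<Longrightarrow> m i = n - 1"
    and "\<And>i. s + 1 \<le> i \<Longrightarrow> i \<le> n - 1 \<Longrightarrow> m i = n"
  shows "chrom_qsf {1..n} (inc_edge n m) =
           (\<lambda>\<alpha>. qfact (n - 4) *
              (  (qint n * qint (n - 3) * qint (r - 1) * qint (n - s - 1)) * elem_part [n] \<alpha>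
               + smult (1/2) (qint (n - 2) *
                   (  ([:0, 1:] ^ (r - 1) + [:0, 1:] ^ (n - s - 1)) * qint (n - 3)
                    + [:0, 1:] ^ (n - s - 1) * qint 2 * qint (r - 2) * qint (s - 1)
                    + [:0, 1:] ^ (r - 1) * qint 2 * qint (n - r - 1) * qint (n - s - 2)))
                   * elem_part [n - 1, 1] \<alpha>
               + ([:0, 1:] ^ (n + r - s - 3) * qint 2 * qint (n - r - 1) * qint (s - 1))
                   * elem_part [n - 2, 2] \<alpha>))
         \<and> e_positive (chrom_qsf {1..n} (inc_edge n m))
         \<and> e_unimodal (chrom_qsf {1..n} (inc_edge n m))
              ((of_int (int (n choose 2)) - of_int (int n - int r + int s - 1)) / 2)"
proof -
  \<comment> \<open>The three blocks have sizes i + 1, b and j + 1.\<close>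
  define i b j where "i = s - 2" and "b = r - s" and "j = n - r - 2"
  have srn: "s = i + 2" "r = i + b + 2" "n = i + b + j + 4"
    using assms(1-3) by (auto simp: i_def b_def j_def)
  have sub: "n - 4 = i + b + j" "n - 3 = i + b + j + 1" "n - 2 = i + b + j + 2" "r - 1 = i + b + 1" "n - s - 1 = b + j + 1"
    "r - 2 = i + b" "s - 1 = i + 1" "n - r - 1 = j + 1" "n - s - 2 = b + j" "n + r - s - 3 = i + 2 * b + j + 1"
    unfolding srn by auto
  have "clique_with_ends (inc_edge n m) s r n"
  proof
    fix u v :: nat
    show "inc_edge n m u v \<longleftrightarrow> inc_edge n m v u" "\<not> inc_edge n m u u"
      by (auto simp: inc_edge_def)
    show "1 \<le> s" "s \<le> r" "r < n" using assms(1-3) by auto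
    assume uv: "1 \<le> u" "u < v" "v \<le> n"
    consider "u = 1" | "2 \<le> u" "u \<le> s" | "s + 1 \<le> u" using uv by linarith
    then have "m u < v \<longleftrightarrow> u = 1 \<and> r < v \<or> v = n \<and> u \<le> s"
    proof cases
      case 1
      then show ?thesis using assms(1-4) by auto
    next
      case 2
      then show ?thesis using assms(5)[of u] uv by auto
    next
      case 3
      then show ?thesis using assms(6)[of u] uv assms(1-3) by auto
    qed
    moreover have "\<not> nuio_less n m v u"
    proof
      assume "nuio_less n m v u"
      then have v: "v < n" "m v < u" by (auto simp: nuio_less_def)
      consider "v \<le> s" | "s + 1 \<le> v" by linarith
      then have "u \<le> m v"
        using assms(5)[of v] assms(6)[of v] uv v(1) by cases auto
      then show False using v by simp
    qed
    ultimately show "inc_edge n m u v \<longleftrightarrow> \<not> (u = 1 \<and> r < v) \<and> \<not> (v = n \<and> u \<le> s)"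
      using uv by (auto simp: inc_edge_def nuio_less_def)
  qed
  then have E: "clique_with_ends (inc_edge n m) (i + 2) (i + b + 2) (i + b + j + 4)"
    unfolding srn .
  let ?q = "qfact (i + b + j)"
  let ?C0 = "qint n * qint (i + b + j + 1) * qint (i + b + 1) * qint (b + j + 1)"
  let ?C1 = "smult (1 / 2) (qint (i + b + j + 2) *
        (([:0, 1:] ^ (i + b + 1) + [:0, 1:] ^ (b + j + 1)) * qint (i + b + j + 1)
         + [:0, 1:] ^ (b + j + 1) * qint 2 * qint (i + b) * qint (i + 1)
         + [:0, 1:] ^ (i + b + 1) * qint 2 * qint (j + 1) * qint (b + j)))"
  let ?C2 = "[:0, 1:] ^ (i + 2 * b + j + 1) * qint 2 * qint (j + 1) * qint (i + 1)"
  have main: "chrom_qsf {1..n} (inc_edge n m) = (\<lambda>\<alpha>. ?q * (?C0 * elem_part [n] \<alpha>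
      + ?C1 * elem_part [n - 1, 1] \<alpha> + ?C2 * elem_part [n - 2, 2] \<alpha>))"
    using chrom_qsf_elementary[OF E] unfolding srn(3)[symmetric] .
  \<comment> \<open>Twice the centre shared by the three coefficients before [n-4]! is multiplied
    in; C(n-4,2) + D is the number of edges.\<close>
  define D where "D = 3 * i + 4 * b + 3 * j + 3"
  have "sym_unimodal D ?C0"
  proof -
    have "sym_unimodal (0 + (b + j) + (i + b) + (i + b + j) + (i + b + j + 3))
        (qint (Suc (i + b + j + 3)) * (qint (Suc (i + b + j)) * (qint (Suc (i + b)) * (qint (Suc (b + j)) * 1))))"
      by (intro sym_unimodal_qint_mult sym_unimodal_1)
    moreover have "0 + (b + j) + (i + b) + (i + b + j) + (i + b + j + 3) = D" by (simp add: D_def)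
    moreover have "Suc (i + b + j + 3) = n" by (simp add: srn)
    ultimately show ?thesis by (simp only: mult.assoc mult_1_right Suc_eq_plus1)
  qed
  have "sym_unimodal D ?C1"
  proof -
    \<comment> \<open>D minus the degree n - 3 of the factor [n-2].\<close>
    define d where "d = 2 * i + 3 * b + 2 * j + 2"
    \<comment> \<open>For i \<noteq> j the two products have different centres; exchanging right
      ends moves both to d / 2.\<close>
    have 1: "sym_unimodal d (([:0, 1:] ^ (i + b + 1) + [:0, 1:] ^ (b + j + 1)) * qint (i + b + j + 1))"
    proof -
      have d: "b + 2 * j + 2 * (i + b + 1) = d" "b + 2 * i + 2 * (b + j + 1) = d" by (simp_all add: d_def)
      have "sym_unimodal (b + 2 * j + 2 * (i + b + 1)) ([:0, 1:] ^ (i + b + 1) * qint (Suc (b + 2 * j)))"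
        "sym_unimodal (b + 2 * i + 2 * (b + j + 1)) ([:0, 1:] ^ (b + j + 1) * qint (Suc (b + 2 * i)))"
        by (intro sym_unimodal_pow_mult sym_unimodal_qint)+
      then have "sym_unimodal d ([:0, 1:] ^ (i + b + 1) * qint (Suc (b + 2 * j)))"
        "sym_unimodal d ([:0, 1:] ^ (b + j + 1) * qint (Suc (b + 2 * i)))"
        using d(1,2) by (simp_all only:)
      moreover have "i + b + j + 1 + (b + j + 1) - (i + b + 1) = Suc (b + 2 * j)"
        "i + b + j + 1 + (i + b + 1) - (b + j + 1) = Suc (b + 2 * i)" by simp_all
      moreover have "i + b + 1 \<le> i + b + j + 1 + (b + j + 1)" "b + j + 1 \<le> i + b + j + 1 + (i + b + 1)" by simp_all
      ultimately show ?thesis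
        by (simp only: pow_add_pow_mult_qint sym_unimodal_add)
    qed
    \<comment> \<open>If i + b = 0, the factor [i+b] is 0 and has no degree i + b - 1 to count, but
      the whole summand vanishes. The third summand is treated alike.\<close>
    have 2: "sym_unimodal d ([:0, 1:] ^ (b + j + 1) * qint 2 * qint (i + b) * qint (i + 1))"
    proof (cases "i + b")
      case 0
      then show ?thesis by (simp add: sym_unimodal_0)
    next
      case (Suc h)
      have "sym_unimodal (i + h + 1 + 2 * (b + j + 1)) ([:0, 1:] ^ (b + j + 1) * (qint (Suc 1) * (qint (Suc h) * qint (Suc i))))"
        by (intro sym_unimodal_pow_mult sym_unimodal_qint_mult sym_unimodal_qint)
      moreover have "i + h + 1 + 2 * (b + j + 1) = d" using Suc by (simp add: d_def)
      ultimately show ?thesis by (simp add: Suc mult.assoc numeral_2_eq_2)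
    qed
    have 3: "sym_unimodal d ([:0, 1:] ^ (i + b + 1) * qint 2 * qint (j + 1) * qint (b + j))"
    proof (cases "b + j")
      case 0
      then show ?thesis by (simp add: sym_unimodal_0)
    next
      case (Suc h)
      have "sym_unimodal (h + j + 1 + 2 * (i + b + 1)) ([:0, 1:] ^ (i + b + 1) * (qint (Suc 1) * (qint (Suc j) * qint (Suc h))))"
        by (intro sym_unimodal_pow_mult sym_unimodal_qint_mult sym_unimodal_qint)
      moreover have "h + j + 1 + 2 * (i + b + 1) = d" using Suc by (simp add: d_def)
      ultimately show ?thesis by (simp add: Suc mult.assoc numeral_2_eq_2)
    qed
    have "sym_unimodal (d + (i + b + j + 1)) (smult (1 / 2) (qint (Suc (i + b + j + 1)) *
        (([:0, 1:] ^ (i + b + 1) + [:0, 1:] ^ (b + j + 1)) * qint (i + b + j + 1)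
         + [:0, 1:] ^ (b + j + 1) * qint 2 * qint (i + b) * qint (i + 1)
         + [:0, 1:] ^ (i + b + 1) * qint 2 * qint (j + 1) * qint (b + j))))"
      by (intro sym_unimodal_smult sym_unimodal_qint_mult sym_unimodal_add 1 2 3) simp
    moreover have "d + (i + b + j + 1) = D" "Suc (i + b + j + 1) = i + b + j + 2" by (simp_all add: D_def d_def)
    ultimately show ?thesis by (simp only:)
  qed
  have "sym_unimodal D ?C2"
  proof -
    have "sym_unimodal (i + j + 1 + 2 * (i + 2 * b + j + 1)) ([:0, 1:] ^ (i + 2 * b + j + 1) * (qint (Suc 1) * (qint (Suc j) * qint (Suc i))))"
      by (intro sym_unimodal_pow_mult sym_unimodal_qint_mult sym_unimodal_qint)
    moreover have "i + j + 1 + 2 * (i + 2 * b + j + 1) = D" by (simp add: D_def)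
    ultimately show ?thesis by (simp add: mult.assoc numeral_2_eq_2)
  qed
  have "e_positive (chrom_qsf {1..n} (inc_edge n m)) \<and> e_unimodal (chrom_qsf {1..n} (inc_edge n m))
              ((of_int (int (n choose 2)) - of_int (int n - int r + int s - 1)) / 2)"
  proof (rule e_unimodal_combination)
    show "4 \<le> n" by (simp add: srn)
    show "chrom_qsf {1..n} (inc_edge n m) = (\<lambda>\<alpha>. (?q * ?C0) * elem_part [n] \<alpha>
      + (?q * ?C1) * elem_part [n - 1, 1] \<alpha> + (?q * ?C2) * elem_part [n - 2, 2] \<alpha>)"
      unfolding main by (simp only: distrib_left mult.assoc)
    show "sym_unimodal ((i + b + j choose 2) + D) (?q * ?C0)" "sym_unimodal ((i + b + j choose 2) + D) (?q * ?C1)"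
      "sym_unimodal ((i + b + j choose 2) + D) (?q * ?C2)"
      by (intro sym_unimodal_qfact_mult; fact)+
    show "of_nat ((i + b + j choose 2) + D) =
      2 * ((of_int (int (n choose 2)) - of_int (int n - int r + int s - 1)) / (2 :: rat))"
      unfolding srn choose_two_plus_4 by (simp add: D_def)
  qed
  then show ?thesis unfolding sub main by blast
qed

end
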